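(* Let $\beta$ be a non-degenerate alternating, symmetric or hermitian form on a finite-dimensional vector space $V$ over $F$ (with $q$ odd if $\beta$ is symmetric), let $\mathcal{C}=\mathcal{C}(\beta)$ be its group of isometries and let $X_1,X_2\in\mathcal{C}$ be semisimple. If $\mathcal{C}$ is a symplectic or a unitary group (i.e. $\beta$ is alternating or hermitian), then $X_1$ and $X_2$ are conjugate in $\mathcal{C}$ if, and only if, they are similar (conjugate in $\mathrm{GL}(V)$). If $\mathcal{C}$ is an orthogonal group (i.e. $\beta$ is symmetric and $q$ is odd), then $X_1$ and $X_2$ are conjugate in $\mathcal{C}$ if, and only if, they are similar and, for each $\lambda\in\{+1,-1\}$, the restrictions of $\beta$ to the eigenspaces $\ker(X_1-\lambda)$ and $\ker(X_2-\lambda)$ have the same type, i.e. are congruent.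
   Context: $F=\mathbb{F}_{q^2}$ with $\overline\lambda=\lambda^q$ if $\beta$ is hermitian, and $F=\mathbb{F}_q$ otherwise. $\mathcal{C}(\beta)$ is the group of all $X\in\mathrm{GL}(V)$ with $\beta(uX,vX)=\beta(u,v)$ for all $u,v\in V$. An element of $\mathrm{GL}(V)$ is semisimple if its order is coprime to the characteristic of $F$. Two forms $\beta_1,\beta_2$ on spaces $V_1,V_2$ are congruent if there is a linear isomorphism $T:V_2\to V_1$ with $\beta_1(uT,vT)=\beta_2(u,v)$ for all $u,v$. Over $\mathbb{F}_q$ with $q$ odd there are exactly two congruence classes of non-degenerate symmetric forms in each positive dimension (plus and minus type in even dimension). The form on the zero space is regarded as unique. *)

theory Defs
  imports "HOL-Algebra.Multiplicative_Group" "HOL-Library.Cardinality"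
begin

text \<open>
  Linear maps act on the right, as in \<open>uX\<close>: the product \<open>X Y\<close> in the general linear
  group is "first \<open>X\<close>, then \<open>Y\<close>". The vector space is the whole type \<open>'v\<close>, with scalar
  multiplication \<open>scale\<close>; the zero space is not excluded.
\<close>

definition general_linear ::
  "('f::field \<Rightarrow> 'v::ab_group_add \<Rightarrow> 'v) \<Rightarrow> ('v \<Rightarrow> 'v) monoid" where
  "general_linear scale =
    \<lparr>carrier = {X. Vector_Spaces.linear scale scale X \<and> bij X},
     mult = (\<lambda>X Y. Y \<circ> X), one = id\<rparr>"

definition isometry_group ::
  "('f::field \<Rightarrow> 'v::ab_group_add \<Rightarrow> 'v) \<Rightarrow> ('v \<Rightarrow> 'v \<Rightarrow> 'f) \<Rightarrow> ('v \<Rightarrow> 'v) monoid" where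
  "isometry_group scale \<beta> =
    (general_linear scale)\<lparr>carrier :=
      {X \<in> carrier (general_linear scale). \<forall>u v. \<beta> (X u) (X v) = \<beta> u v}\<rparr>"

definition conjugate_in :: "('a, 'b) monoid_scheme \<Rightarrow> 'a \<Rightarrow> 'a \<Rightarrow> bool" where
  "conjugate_in G x y \<longleftrightarrow>
    (\<exists>g \<in> carrier G. y = inv\<^bsub>G\<^esub> g \<otimes>\<^bsub>G\<^esub> x \<otimes>\<^bsub>G\<^esub> g)"

definition semisimple :: "('f::field \<Rightarrow> 'v::ab_group_add \<Rightarrow> 'v) \<Rightarrow> ('v \<Rightarrow> 'v) \<Rightarrow> bool" where
  "semisimple scale X \<longleftrightarrow>
    X \<in> carrier (general_linear scale) \<and>
    coprime (group.ord (general_linear scale) X) CHAR('f)"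

definition eigenspace ::
  "('f::field \<Rightarrow> 'v::ab_group_add \<Rightarrow> 'v) \<Rightarrow> ('v \<Rightarrow> 'v) \<Rightarrow> 'f \<Rightarrow> 'v set" where
  "eigenspace scale X c = {v. X v - scale c v = 0}"

definition bilinear_form ::
  "('f::field \<Rightarrow> 'v::ab_group_add \<Rightarrow> 'v) \<Rightarrow> ('v \<Rightarrow> 'v \<Rightarrow> 'f) \<Rightarrow> bool" where
  "bilinear_form scale \<beta> \<longleftrightarrow>
    (\<forall>v. Vector_Spaces.linear scale (*) (\<lambda>u. \<beta> u v)) \<and>
    (\<forall>u. Vector_Spaces.linear scale (*) (\<lambda>v. \<beta> u v))"

definition alternating_form ::
  "('f::field \<Rightarrow> 'v::ab_group_add \<Rightarrow> 'v) \<Rightarrow> ('v \<Rightarrow> 'v \<Rightarrow> 'f) \<Rightarrow> bool" where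
  "alternating_form scale \<beta> \<longleftrightarrow> bilinear_form scale \<beta> \<and> (\<forall>v. \<beta> v v = 0)"

definition symmetric_form ::
  "('f::field \<Rightarrow> 'v::ab_group_add \<Rightarrow> 'v) \<Rightarrow> ('v \<Rightarrow> 'v \<Rightarrow> 'f) \<Rightarrow> bool" where
  "symmetric_form scale \<beta> \<longleftrightarrow> bilinear_form scale \<beta> \<and> (\<forall>u v. \<beta> v u = \<beta> u v)"

text \<open>
  The conjugation is \<open>c \<mapsto> c ^ q\<close>, which is the involutory automorphism when the field has
  \<open>q\<^sup>2\<close> elements. Semilinearity in the second argument follows from the two conditions.
\<close>

definition hermitian_form ::
  "nat \<Rightarrow> ('f::field \<Rightarrow> 'v::ab_group_add \<Rightarrow> 'v) \<Rightarrow> ('v \<Rightarrow> 'v \<Rightarrow> 'f) \<Rightarrow> bool" where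
  "hermitian_form q scale \<beta> \<longleftrightarrow>
    (\<forall>v. Vector_Spaces.linear scale (*) (\<lambda>u. \<beta> u v)) \<and>
    (\<forall>u v. \<beta> v u = \<beta> u v ^ q)"

text \<open>
  For alternating, symmetric and hermitian forms the left and right radicals coincide.
\<close>

definition nondegenerate :: "('v::zero \<Rightarrow> 'v \<Rightarrow> 'f::zero) \<Rightarrow> bool" where
  "nondegenerate \<beta> \<longleftrightarrow> (\<forall>u. (\<forall>v. \<beta> u v = 0) \<longrightarrow> u = 0)"

text \<open>
  Congruence of the restriction of \<open>\<beta>1\<close> to the subspace \<open>V1\<close> with the restriction of \<open>\<beta>2\<close> to
  the subspace \<open>V2\<close>. The isomorphism \<open>T\<close> matters only on \<open>V2\<close>, so linearity is
  required there only.
\<close>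

definition congruent_on ::
  "('f::field \<Rightarrow> 'v::ab_group_add \<Rightarrow> 'v) \<Rightarrow> ('v \<Rightarrow> 'v \<Rightarrow> 'f) \<Rightarrow> 'v set \<Rightarrow>
   ('f \<Rightarrow> 'w::ab_group_add \<Rightarrow> 'w) \<Rightarrow> ('w \<Rightarrow> 'w \<Rightarrow> 'f) \<Rightarrow> 'w set \<Rightarrow> bool" where
  "congruent_on scale1 \<beta>1 V1 scale2 \<beta>2 V2 \<longleftrightarrow>
    (\<exists>T. bij_betw T V2 V1 \<and>
      (\<forall>u\<in>V2. \<forall>v\<in>V2. T (u + v) = T u + T v) \<and>
      (\<forall>c. \<forall>v\<in>V2. T (scale2 c v) = scale1 c (T v)) \<and>
      (\<forall>u\<in>V2. \<forall>v\<in>V2. \<beta>1 (T u) (T v) = \<beta>2 u v))"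

lemma group_general_linear:
  assumes "vector_space scale"
  shows "group (general_linear scale)"
proof -
  interpret V: vector_space scale by fact
  interpret VV: vector_space_pair scale scale ..
  show ?thesis
  proof (rule groupI)
    fix X assume "X \<in> carrier (general_linear scale)"
    then have X: "Vector_Spaces.linear scale scale X" "bij X"
      by (auto simp: general_linear_def)
    let ?Y = "inv_into UNIV X"
    have inv: "X (?Y v) = v" for v
      using X(2) by (simp add: bij_is_surj surj_f_inv_f)
    have "Vector_Spaces.linear scale scale ?Y"
    proof (unfold Vector_Spaces.linear_iff, intro conjI allI V.vector_space_axioms)
      fix u v
      have "X (?Y u + ?Y v) = u + v"
        using VV.linear_add[OF X(1)] inv by simp
      then show "?Y (u + v) = ?Y u + ?Y v"
        using X(2) by (metis bij_inv_eq_iff)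
    next
      fix c v
      have "X (scale c (?Y v)) = scale c v"
        using VV.linear_scale[OF X(1)] inv by simp
      then show "?Y (scale c v) = scale c (?Y v)"
        using X(2) by (metis bij_inv_eq_iff)
    qed
    then show "\<exists>Y\<in>carrier (general_linear scale).
        Y \<otimes>\<^bsub>general_linear scale\<^esub> X = \<one>\<^bsub>general_linear scale\<^esub>"
      using X inv
      by (intro bexI[of _ "?Y"]) (auto simp: general_linear_def bij_imp_bij_inv fun_eq_iff)
  qed (auto simp: general_linear_def o_assoc bij_comp V.linear_id intro: Vector_Spaces.linear_compose)
qed

lemma subgroup_isometry_group:
  assumes "vector_space scale"
  shows "subgroup (carrier (isometry_group scale \<beta>)) (general_linear scale)"
proof -
  interpret G: group "general_linear scale"
    using assms by (rule group_general_linear)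
  show ?thesis
  proof (rule G.subgroupI)
    fix X assume X: "X \<in> carrier (isometry_group scale \<beta>)"
    let ?Y = "inv\<^bsub>general_linear scale\<^esub> X"
    have GX: "X \<in> carrier (general_linear scale)"
      using X by (simp add: isometry_group_def)
    have XY: "X (?Y v) = v" for v
      using G.l_inv[OF GX] by (simp add: general_linear_def fun_eq_iff)
    have "\<beta> (?Y u) (?Y v) = \<beta> u v" for u v
    proof -
      have "\<beta> (X (?Y u)) (X (?Y v)) = \<beta> (?Y u) (?Y v)"
        using X unfolding isometry_group_def by simp
      then show ?thesis
        by (simp add: XY)
    qed
    then show "?Y \<in> carrier (isometry_group scale \<beta>)"
      using G.inv_closed[OF GX] by (simp add: isometry_group_def)
  next
    fix X Y
    assume "X \<in> carrier (isometry_group scale \<beta>)" "Y \<in> carrier (isometry_group scale \<beta>)"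
    then show "X \<otimes>\<^bsub>general_linear scale\<^esub> Y \<in> carrier (isometry_group scale \<beta>)"
      using G.m_closed[of X Y] by (simp add: isometry_group_def) (simp add: general_linear_def)
  next
    have "\<one>\<^bsub>general_linear scale\<^esub> \<in> carrier (isometry_group scale \<beta>)"
      using G.one_closed by (simp add: isometry_group_def) (simp add: general_linear_def)
    then show "carrier (isometry_group scale \<beta>) \<noteq> {}"
      by blast
  qed (simp add: isometry_group_def)
qed

lemma group_isometry_group:
  assumes "vector_space scale"
  shows "group (isometry_group scale \<beta>)"
  using group.subgroup_imp_group[OF group_general_linear subgroup_isometry_group] assms
  by (simp add: isometry_group_def)

end

theory Submission
  imports Defs "HOL-Algebra.Sylow" "HOL-Computational_Algebra.Primes"
    "HOL-Computational_Algebra.Polynomial"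
begin

text \<open>
  Let \<open>g\<close> conjugate \<open>X\<^sub>1 = X\<close> to \<open>X\<^sub>2\<close> and put \<open>\<gamma>(u, v) = \<beta>(g u, g v)\<close>. Then \<open>X\<close> preserves both
  \<open>\<beta>\<close> and \<open>\<gamma>\<close>, and the two elements are conjugate in the isometry group as soon as some \<open>T\<close>
  commuting with \<open>X\<close> satisfies \<open>\<beta>(T u, T v) = \<gamma>(u, v)\<close>. Write \<open>\<gamma>(u, v) = \<beta>(A u, v)\<close> with
  \<open>A\<close> self-adjoint and commuting with \<open>X\<close>; the task becomes \<open>T\<^sup>* T = A\<close>.

  If some operator \<open>W\<close> commutes with \<open>A\<close> and \<open>W - W\<^sup>*\<close> is invertible, look for \<open>T = x + y W\<close>, where
  \<open>x\<close>, \<open>y\<close> lie in a finite commutative ring of self-adjoint operators: \<open>A\<close> has to be represented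
  by a non-singular binary quadratic form over that ring, and such a form represents every unit.
  For hermitian forms \<open>W\<close> is a scalar not fixed by the conjugation. Otherwise \<open>W = X\<close> works off
  the eigenvalues \<open>1\<close>, \<open>-1\<close>, where \<open>X - X\<^sup>*\<close> is invertible; semisimplicity splits \<open>V\<close>
  orthogonally into this part and the two eigenspaces. On these \<open>X\<close> is scalar, so only the congruence of
  the restricted forms matters, which is automatic for alternating forms.
\<close>

section \<open>Binary quadratic forms over finite commutative rings\<close>

text \<open>The obstacle is that \<open>A\<close> merely commutes with \<open>X\<close> and need not
  be semisimple, so the ring in which \<open>x\<close> and \<open>y\<close> are sought may contain
  nilpotents and is no product of fields. A unit is therefore represented modulo the radical, and
  the error is corrected inside the radical.

  Commutativity comes from a double commutant: its members commute with each other and with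
  everything that commutes with \<open>A\<close>, \<open>W\<close> and the adjoint of
  \<open>W\<close>. This also makes the resulting \<open>T\<close> linear over the scalars and
  equivariant.

  Which form is non-singular depends on the characteristic. In \<open>x^2 + t x y + n y^2\<close>
  the coefficients are the trace \<open>t = W + W^*\<close> and the norm \<open>n = W W^*\<close>.
  If 2 = 0, then \<open>t = W - W^*\<close> is a unit, and squaring is additive, which solves the
  equation up to nilpotents. If 2 is invertible, \<open>W\<close> is replaced by its skew part
  \<open>W - W^*\<close>: now \<open>t = 0\<close>, the new \<open>n\<close> is minus the square of
  a unit, and the question is about \<open>x^2 + n y^2\<close> with \<open>n\<close> a unit, settled
  by counting squares in local rings.\<close>

lemma (in cring) Units_if_inj_mult:
  assumes "finite (carrier R)" "a \<in> carrier R" "inj_on (\<lambda>x. a \<otimes> x) (carrier R)"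
  shows "a \<in> Units R"
proof -
  have "(\<lambda>x. a \<otimes> x) ` carrier R = carrier R"
    using assms by (intro card_subset_eq) (auto simp: card_image)
  then obtain x where "x \<in> carrier R" "a \<otimes> x = \<one>"
    using one_closed by (metis (no_types, lifting) imageE)
  then show ?thesis
    using assms(2) by (auto simp: Units_def m_comm intro!: bexI[of _ x])
qed

lemma (in cring) Units_mult_cancel_zero:
  assumes "u \<in> Units R" "x \<in> carrier R" "u \<otimes> x = \<zero>"
  shows "x = \<zero>"
  using assms by (metis Units_closed Units_l_cancel r_null zero_closed)

text \<open>The elementwise characterisation of the Jacobson radical; it permits arguing with units
  alone, without maximal ideals.\<close>

definition (in cring) jacobson :: "'a set" where
  "jacobson = {x \<in> carrier R. \<forall>r\<in>carrier R. \<one> \<ominus> r \<otimes> x \<in> Units R}"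

lemma (in cring) jacobsonD: "x \<in> jacobson \<Longrightarrow> r \<in> carrier R \<Longrightarrow> \<one> \<ominus> r \<otimes> x \<in> Units R"
  by (simp add: jacobson_def)

lemma (in cring) jacobson_closed: "x \<in> jacobson \<Longrightarrow> x \<in> carrier R"
  by (simp add: jacobson_def)

lemma (in cring) jacobson_mult: "x \<in> jacobson \<Longrightarrow> r \<in> carrier R \<Longrightarrow> r \<otimes> x \<in> jacobson"
  by (auto simp: jacobson_def m_assoc[symmetric])

text \<open>Factoring out \<open>u\<close> leaves \<open>1 + u^-1 x\<close>, which is a unit by the
  definition of the radical.\<close>

lemma (in cring) Units_add_jacobson:
  assumes "u \<in> Units R" "x \<in> jacobson"
  shows "u \<oplus> x \<in> Units R"
proof -
  have c: "x \<in> carrier R" "u \<in> carrier R" "inv u \<in> carrier R"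
    using assms by (auto simp: jacobson_closed)
  have "u \<otimes> (\<one> \<ominus> (\<ominus> (inv u)) \<otimes> x) = u \<oplus> (u \<otimes> inv u) \<otimes> x"
    using c by algebra
  also have "\<dots> = u \<oplus> x"
    using assms c by simp
  finally show ?thesis
    using jacobsonD[OF assms(2), of "\<ominus> (inv u)"] assms(1) c
    by (metis Units_m_closed a_inv_closed)
qed

text \<open>\<open>1 - r (x + y)\<close> is the unit \<open>1 - r x\<close> perturbed by the radical
  element \<open>- r y\<close>.\<close>

lemma (in cring) jacobson_add:
  assumes "x \<in> jacobson" "y \<in> jacobson"
  shows "x \<oplus> y \<in> jacobson"
proof -
  have c: "x \<in> carrier R" "y \<in> carrier R"
    using assms by (auto simp: jacobson_closed)
  have "\<one> \<ominus> r \<otimes> (x \<oplus> y) \<in> Units R" if r: "r \<in> carrier R" for r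
  proof -
    have "\<one> \<ominus> r \<otimes> (x \<oplus> y) = (\<one> \<ominus> r \<otimes> x) \<oplus> (\<ominus> r) \<otimes> y"
      using c r by algebra
    then show ?thesis
      using Units_add_jacobson jacobsonD[OF assms(1) r] jacobson_mult[OF assms(2), of "\<ominus> r"] r
      by simp
  qed
  then show ?thesis
    using c by (simp add: jacobson_def)
qed

lemma (in cring) nilpotent_imp_jacobson:
  assumes "x \<in> carrier R" "x [^] (k::nat) = \<zero>"
  shows "x \<in> jacobson"
proof -
  have "\<one> \<ominus> r \<otimes> x \<in> Units R" if r: "r \<in> carrier R" for r
  proof -
    define z where "z = r \<otimes> x"
    have z: "z \<in> carrier R"
      using assms r by (simp add: z_def)
    \<comment> \<open>The witness \<open>s\<close> is the geometric sum
      \<open>1 + z + ... + z^(k-1)\<close>.\<close>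
    have "\<exists>s\<in>carrier R. (\<one> \<ominus> z) \<otimes> s = \<one> \<ominus> z [^] k" for k :: nat
    proof (induction k)
      case 0
      then show ?case
        using z by (intro bexI[of _ \<zero>]) (auto simp: minus_eq r_neg)
    next
      case (Suc k)
      then obtain s where s: "s \<in> carrier R" "(\<one> \<ominus> z) \<otimes> s = \<one> \<ominus> z [^] k"
        by blast
      have "(\<one> \<ominus> z) \<otimes> (s \<oplus> z [^] k) = (\<one> \<ominus> z) \<otimes> s \<oplus> (z [^] k \<ominus> z [^] k \<otimes> z)"
        using z s(1) nat_pow_closed[OF z, of k] by algebra
      also have "\<dots> = \<one> \<ominus> z [^] Suc k"
      proof -
        have "\<one> \<ominus> p \<oplus> (p \<ominus> p \<otimes> z) = \<one> \<ominus> p \<otimes> z" if "p \<in> carrier R" for p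
          using z that by algebra
        then show ?thesis
          using z by (simp add: s(2))
      qed
      finally show ?case
        using z s(1) by (intro bexI[of _ "s \<oplus> z [^] k"]) auto
    qed
    then obtain s where s: "s \<in> carrier R" "(\<one> \<ominus> z) \<otimes> s = \<one> \<ominus> z [^] k"
      by blast
    moreover have "z [^] k = \<zero>"
      using assms r by (simp add: z_def nat_pow_distrib)
    ultimately have "(\<one> \<ominus> z) \<otimes> s = \<one>"
      by (simp add: minus_eq)
    then show ?thesis
      using z s(1) unfolding z_def[symmetric] Units_def
      by (auto simp: m_comm intro!: bexI[of _ s])
  qed
  then show ?thesis
    using assms by (simp add: jacobson_def)
qed

text \<open>The map \<open>y \<mapsto> t y + n y\<^sup>2\<close> is injective on the radical because \<open>t + n (y + z)\<close> is a
  unit there; by finiteness it is onto. This replaces a Hensel lifting.\<close>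

lemma (in cring) quadratic_onto_jacobson:
  assumes "finite (carrier R)" "t \<in> Units R" "n \<in> carrier R" "\<nu> \<in> jacobson"
  shows "\<exists>y\<in>jacobson. t \<otimes> y \<oplus> n \<otimes> (y \<otimes> y) = \<nu>"
proof -
  let ?g = "\<lambda>y. t \<otimes> y \<oplus> n \<otimes> (y \<otimes> y)"
  have t: "t \<in> carrier R"
    using assms by auto
  have "inj_on ?g jacobson"
  proof (rule inj_onI)
    fix y z assume yz: "y \<in> jacobson" "z \<in> jacobson" "?g y = ?g z"
    then have c: "y \<in> carrier R" "z \<in> carrier R"
      by (auto simp: jacobson_closed)
    have "(t \<oplus> n \<otimes> (y \<oplus> z)) \<otimes> (y \<ominus> z) = ?g y \<ominus> ?g z"
      using c t assms(3) by algebra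
    also have "\<dots> = \<zero>"
      using yz(3) c t assms(3) by (simp add: r_right_minus_eq)
    finally have "y \<ominus> z = \<zero>"
      using Units_mult_cancel_zero[OF Units_add_jacobson[OF assms(2)
          jacobson_mult[OF jacobson_add[OF yz(1,2)] assms(3)]]] minus_closed[OF c]
      by blast
    then show "y = z"
      using c by (simp add: r_right_minus_eq)
  qed
  moreover have "finite jacobson"
    using assms(1) by (rule finite_subset[rotated]) (auto simp: jacobson_def)
  moreover have "?g ` jacobson \<subseteq> jacobson"
    using assms(3) t by (auto intro!: jacobson_add jacobson_mult simp: jacobson_closed)
  ultimately have "?g ` jacobson = jacobson"
    by (simp add: endo_inj_surj)
  then show ?thesis
    using assms(4) by (metis (no_types, lifting) imageE)
qed

text \<open>Squaring is additive here, and by finiteness the iterated squares of \<open>a\<close>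
  repeat. Hence \<open>a\<close> differs from some square \<open>s^2\<close> by a nilpotent element.
  With \<open>x = s\<close> kept fixed, that error is absorbed by \<open>t s y + n y^2\<close>,
  because \<open>t s\<close> is a unit.\<close>

lemma (in cring) char2_unit_represented:
  assumes fin: "finite (carrier R)" and two: "\<one> \<oplus> \<one> = \<zero>"
    and t: "t \<in> Units R" and n: "n \<in> carrier R" and a: "a \<in> Units R"
  shows "\<exists>x\<in>carrier R. \<exists>y\<in>carrier R. a = x \<otimes> x \<oplus> t \<otimes> (x \<otimes> y) \<oplus> n \<otimes> (y \<otimes> y)"
proof -
  have ac: "a \<in> carrier R" and tc: "t \<in> carrier R"
    using a t by auto
  have dbl: "x \<oplus> x = \<zero>" if "x \<in> carrier R" for x
  proof -
    have "x \<oplus> x = (\<one> \<oplus> \<one>) \<otimes> x"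
      using that by algebra
    then show ?thesis
      using that two by simp
  qed
  have sq: "(x \<ominus> y) \<otimes> (x \<ominus> y) = x \<otimes> x \<ominus> y \<otimes> y" if "x \<in> carrier R" "y \<in> carrier R" for x y
  proof -
    have "(x \<ominus> y) \<otimes> (x \<ominus> y) = (x \<otimes> x \<ominus> y \<otimes> y) \<oplus> (y \<otimes> y \<oplus> y \<otimes> y) \<ominus> (x \<otimes> y \<oplus> x \<otimes> y)"
      using that by algebra
    then show ?thesis
      using that by (simp add: dbl minus_eq)
  qed
  have frob: "(x \<ominus> y) [^] ((2::nat) ^ k) = x [^] ((2::nat) ^ k) \<ominus> y [^] ((2::nat) ^ k)"
    if "x \<in> carrier R" "y \<in> carrier R" for x y k
  proof (induction k)
    case (Suc k)
    have pow: "z [^] ((2::nat) ^ Suc k) = z [^] ((2::nat) ^ k) \<otimes> z [^] ((2::nat) ^ k)"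
      if "z \<in> carrier R" for z
      using that by (simp add: nat_pow_mult mult_2)
    show ?case
      using that by (simp add: pow Suc.IH sq del: power_Suc)
  qed (use that in auto)
  have "\<not> inj (\<lambda>k. a [^] ((2::nat) ^ k))"
  proof
    assume "inj (\<lambda>k. a [^] ((2::nat) ^ k))"
    moreover have "range (\<lambda>k. a [^] ((2::nat) ^ k)) \<subseteq> carrier R"
      using ac by auto
    ultimately show False
      using fin by (meson finite_imageD finite_subset infinite_UNIV_nat)
  qed
  then obtain i j :: nat where "i < j" and eq: "a [^] ((2::nat) ^ i) = a [^] ((2::nat) ^ j)"
    by (metis (no_types, lifting) injI linorder_neqE_nat)
  \<comment> \<open>Chosen so that \<open>s = a^(2^m)\<close> has square
    \<open>a^(2^(j - i))\<close>; raising \<open>a - s^2\<close> to the power \<open>2^i\<close>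
    then yields \<open>a^(2^i) - a^(2^j) = 0\<close>.\<close>
  define m where "m = j - i - 1"
  have j: "j = Suc m + i"
    using \<open>i < j\<close> by (simp add: m_def)
  define s where "s = a [^] ((2::nat) ^ m)"
  have s: "s \<in> Units R" "s \<in> carrier R"
    using a ac by (simp_all add: s_def Units_pow_closed)
  have ss: "s \<otimes> s = a [^] ((2::nat) ^ Suc m)"
    using ac by (simp add: s_def nat_pow_mult mult_2)
  have "(a \<ominus> s \<otimes> s) [^] ((2::nat) ^ i) = a [^] ((2::nat) ^ i) \<ominus> a [^] ((2::nat) ^ j)"
    using ac by (simp add: frob ss nat_pow_pow j mult.assoc power_add)
  also have "\<dots> = \<zero>"
    using ac by (simp add: eq r_right_minus_eq)
  finally have "a \<ominus> s \<otimes> s \<in> jacobson"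
    using ac s by (intro nilpotent_imp_jacobson) auto
  then obtain y where y: "y \<in> jacobson" "(t \<otimes> s) \<otimes> y \<oplus> n \<otimes> (y \<otimes> y) = a \<ominus> s \<otimes> s"
    using quadratic_onto_jacobson[OF fin Units_m_closed[OF t s(1)] n] by blast
  have yc: "y \<in> carrier R"
    using y by (simp add: jacobson_closed)
  have "s \<otimes> s \<oplus> t \<otimes> (s \<otimes> y) \<oplus> n \<otimes> (y \<otimes> y) = s \<otimes> s \<oplus> ((t \<otimes> s) \<otimes> y \<oplus> n \<otimes> (y \<otimes> y))"
    using s yc tc n by algebra
  also have "\<dots> = a"
    unfolding y(2) using ac s by algebra
  finally show ?thesis
    using s yc by metis
qed

text \<open>With \<open>p k\<close> the \<open>k\<close>-th power of an element, this is the
  existence of an idempotent power in a finite monogenic semigroup. The condition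
  \<open>N \<ge> 1\<close> excludes the trivial power 1.\<close>

lemma finite_range_idempotent_index:
  fixes p :: "nat \<Rightarrow> 'a"
  assumes "finite (range p)" and shift: "\<And>i j k. p i = p j \<Longrightarrow> p (i + k) = p (j + k)"
  shows "\<exists>N\<ge>1. p (N + N) = p N"
proof -
  have "\<not> inj p"
    using assms(1) infinite_UNIV_nat by (auto dest: finite_imageD)
  then obtain i j where ij: "i < j" "p i = p j"
    by (metis injI linorder_neqE_nat)
  define k where "k = j - i"
  have k: "k \<ge> 1" "j = i + k"
    using ij by (auto simp: k_def)
  have period: "p (i + m + k * l) = p (i + m)" for m l
  proof (induction l)
    case (Suc l)
    have "p (i + (m + k * l)) = p (j + (m + k * l))"
      using shift ij(2) by blast
    then show ?case
      using Suc by (simp add: k(2) algebra_simps)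
  qed simp
  \<comment> \<open>A multiple of the period \<open>k\<close> that lies beyond the preperiod
    \<open>i\<close>, so that adding \<open>N\<close> to \<open>N\<close> changes nothing.\<close>
  define N where "N = k * (i + 1)"
  have "i \<le> N"
    using mult_le_mono1[OF k(1), of "i + 1"] by (simp add: N_def)
  then have "p (N + N) = p N"
    using period[of "N - i" "i + 1"] by (simp add: N_def)
  moreover have "N \<ge> 1"
    using k(1) by (simp add: N_def)
  ultimately show ?thesis
    by blast
qed

text \<open>For an idempotent \<open>e\<close> this is the factor \<open>eR\<close> of the
  decomposition of \<open>R\<close> into \<open>eR\<close> and \<open>(1 - e)R\<close>; describing
  it by \<open>e x = x\<close> turns membership into an equation.\<close>

definition corner :: "('a, 'b) ring_scheme \<Rightarrow> 'a \<Rightarrow> ('a, 'b) ring_scheme" where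
  "corner R e = R\<lparr>carrier := {x \<in> carrier R. e \<otimes>\<^bsub>R\<^esub> x = x}, one := e\<rparr>"

lemma corner_simps [simp]:
  "carrier (corner R e) = {x \<in> carrier R. e \<otimes>\<^bsub>R\<^esub> x = x}"
  "\<one>\<^bsub>corner R e\<^esub> = e" "\<zero>\<^bsub>corner R e\<^esub> = \<zero>\<^bsub>R\<^esub>"
  "x \<otimes>\<^bsub>corner R e\<^esub> y = x \<otimes>\<^bsub>R\<^esub> y" "x \<oplus>\<^bsub>corner R e\<^esub> y = x \<oplus>\<^bsub>R\<^esub> y"
  by (simp_all add: corner_def)

lemma (in cring) corner_cring:
  assumes e: "e \<in> carrier R" "e \<otimes> e = e"
  shows "cring (corner R e)"
proof (rule cringI)
  show "abelian_group (corner R e)"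
  proof (rule abelian_groupI)
    fix x assume x: "x \<in> carrier (corner R e)"
    then have "\<ominus> x \<in> carrier (corner R e)" "\<ominus> x \<oplus> x = \<zero>"
      using e by (auto simp: r_minus l_neg)
    then show "\<exists>y\<in>carrier (corner R e). y \<oplus>\<^bsub>corner R e\<^esub> x = \<zero>\<^bsub>corner R e\<^esub>"
      by force
  qed (use e in \<open>auto simp: r_distr a_ac\<close>)
  show "comm_monoid (corner R e)"
    using e by (intro comm_monoidI) (auto simp: m_assoc[symmetric] intro: m_comm)
qed (use e in \<open>auto simp: l_distr\<close>)

lemma (in cring) Units_corner:
  assumes e: "e \<in> carrier R" "e \<otimes> e = e" and u: "u \<in> Units R"
  shows "e \<otimes> u \<in> Units (corner R e)"
proof -
  have c: "u \<in> carrier R" "inv u \<in> carrier R"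
    using u by auto
  have "(e \<otimes> inv u) \<otimes> (e \<otimes> u) = (e \<otimes> e) \<otimes> (inv u \<otimes> u)"
    "(e \<otimes> u) \<otimes> (e \<otimes> inv u) = (e \<otimes> e) \<otimes> (inv u \<otimes> u)"
    using c e(1) by algebra+
  then have "(e \<otimes> inv u) \<otimes> (e \<otimes> u) = e" "(e \<otimes> u) \<otimes> (e \<otimes> inv u) = e"
    using u c e by auto
  then show ?thesis
    using c e by (auto simp: Units_def m_assoc[symmetric] intro!: bexI[of _ "e \<otimes> inv u"])
qed

lemma (in cring) Units_divide_square:
  assumes "s \<in> Units R" "t \<in> carrier R" "h \<in> carrier R" "g \<in> carrier R"
    "g \<otimes> (s \<otimes> s) = h \<otimes> (t \<otimes> t)"
  shows "g = h \<otimes> ((t \<otimes> inv s) \<otimes> (t \<otimes> inv s))"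
proof -
  have c: "s \<in> carrier R" "inv s \<in> carrier R"
    using assms by auto
  have "h \<otimes> ((t \<otimes> inv s) \<otimes> (t \<otimes> inv s)) = (h \<otimes> (t \<otimes> t)) \<otimes> (inv s \<otimes> inv s)"
    using c assms by algebra
  also have "\<dots> = (g \<otimes> (s \<otimes> s)) \<otimes> (inv s \<otimes> inv s)"
    by (simp add: assms)
  also have "\<dots> = g \<otimes> (s \<otimes> inv s) \<otimes> (s \<otimes> inv s)"
    using c assms(2-4) by algebra
  also have "\<dots> = g"
    using assms by simp
  finally show ?thesis ..
qed

section \<open>Finite local rings in which 2 is invertible\<close>

locale finite_odd_local_cring = cring +
  assumes fin: "finite (carrier R)"
    and two: "\<one> \<oplus> \<one> \<in> Units R"
    and nontriv: "\<one> \<noteq> \<zero>"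
    and local: "\<And>x. x \<in> carrier R \<Longrightarrow> x \<in> Units R \<or> x \<in> jacobson"
begin

lemma Units_not_jacobson:
  assumes "u \<in> Units R"
  shows "u \<notin> jacobson"
proof
  assume "u \<in> jacobson"
  then have "\<one> \<ominus> inv u \<otimes> u \<in> Units R"
    using jacobsonD assms by blast
  then have "\<zero> \<in> Units R"
    using assms by (simp add: minus_eq r_neg)
  then show False
    using nontriv by (metis Units_mult_cancel_zero one_closed r_one Units_closed l_null)
qed

text \<open>Since \<open>2 x\<close> is a unit, \<open>2 x y + y^2 = \<nu>\<close> has a radical
  solution \<open>y\<close>, and then \<open>(x + y)^2 = x^2 + \<nu>\<close>. So being the square of
  a unit is a property modulo the radical.\<close>

lemma square_add_jacobson:
  assumes "x \<in> Units R" "\<nu> \<in> jacobson"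
  shows "\<exists>s\<in>Units R. x \<otimes> x \<oplus> \<nu> = s \<otimes> s"
proof -
  have x: "x \<in> carrier R"
    using assms by auto
  obtain y where y: "y \<in> jacobson" "((\<one> \<oplus> \<one>) \<otimes> x) \<otimes> y \<oplus> \<one> \<otimes> (y \<otimes> y) = \<nu>"
    using quadratic_onto_jacobson[OF fin Units_m_closed[OF two assms(1)] one_closed assms(2)] by blast
  have yc: "y \<in> carrier R"
    using y by (simp add: jacobson_closed)
  have "x \<otimes> x \<oplus> (((\<one> \<oplus> \<one>) \<otimes> x) \<otimes> y \<oplus> \<one> \<otimes> (y \<otimes> y)) = (x \<oplus> y) \<otimes> (x \<oplus> y)"
    using x yc by algebra
  then show ?thesis
    unfolding y(2) using Units_add_jacobson[OF assms(1) y(1)] by blast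
qed

text \<open>In \<open>(x - y) (x + y) = 0\<close> one factor is a unit and can be cancelled: if both
  lay in the radical, so would their sum \<open>2 x\<close>, a unit.\<close>

lemma square_eq_imp:
  assumes "x \<in> Units R" "y \<in> Units R" "x \<otimes> x = y \<otimes> y"
  shows "x = y \<or> x = \<ominus> y"
proof -
  have c: "x \<in> carrier R" "y \<in> carrier R"
    using assms by auto
  have "(x \<ominus> y) \<otimes> (x \<oplus> y) = x \<otimes> x \<ominus> y \<otimes> y"
    using c by algebra
  then have prod: "(x \<ominus> y) \<otimes> (x \<oplus> y) = \<zero>"
    using c assms(3) by (simp add: r_right_minus_eq)
  consider "x \<ominus> y \<in> Units R" | "x \<oplus> y \<in> Units R" | "x \<ominus> y \<in> jacobson" "x \<oplus> y \<in> jacobson"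
    using local c by blast
  then show ?thesis
  proof cases
    case 1
    then have "x \<oplus> y = \<zero>"
      using Units_mult_cancel_zero prod c by blast
    then show ?thesis
      using sum_zero_eq_neg c by blast
  next
    case 2
    then have "x \<ominus> y = \<zero>"
      using Units_mult_cancel_zero[OF 2, of "x \<ominus> y"] prod c by (simp add: m_comm)
    then show ?thesis
      using c by (simp add: r_right_minus_eq)
  next
    case 3
    have "(x \<ominus> y) \<oplus> (x \<oplus> y) = (\<one> \<oplus> \<one>) \<otimes> x"
      using c by algebra
    then show ?thesis
      using jacobson_add[OF 3] Units_not_jacobson Units_m_closed[OF two assms(1)] by metis
  qed
qed

text \<open>Squaring has fibres of size at most two on the units, so the set \<open>S\<close> of
  squares contains at least half of them. If \<open>a\<close> and \<open>h\<close> were in different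
  square classes, \<open>S\<close>, \<open>h S\<close> and \<open>a S\<close> would be three
  disjoint sets of that size.\<close>

lemma nonsquare_quotient:
  assumes h: "h \<in> Units R" "\<And>s. s \<in> Units R \<Longrightarrow> h \<noteq> s \<otimes> s"
    and a: "a \<in> Units R" "\<And>s. s \<in> Units R \<Longrightarrow> a \<noteq> s \<otimes> s"
  shows "\<exists>w\<in>Units R. a = h \<otimes> (w \<otimes> w)"
proof (rule ccontr)
  assume no: "\<not> ?thesis"
  define S where "S = (\<lambda>x. x \<otimes> x) ` Units R"
  have finU: "finite (Units R)"
    using fin by (rule finite_subset[rotated]) auto
  have finS: "finite S"
    unfolding S_def using finU by simp
  have SU: "S \<subseteq> Units R"
    by (auto simp: S_def)
  have SC: "S \<subseteq> carrier R"
    using SU Units_closed by blast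
  have inj: "inj_on (\<lambda>s. u \<otimes> s) S" if "u \<in> Units R" for u
    using that SC by (auto intro!: inj_onI simp: subset_iff)
  have "card (Units R) = (\<Sum>s\<in>S. card {x \<in> Units R. x \<otimes> x = s})"
    unfolding S_def using sum.image_gen[OF finU, of "\<lambda>_. 1::nat" "\<lambda>x. x \<otimes> x"] by simp
  also have "\<dots> \<le> (\<Sum>s\<in>S. 2)"
  proof (rule sum_mono)
    fix s assume "s \<in> S"
    then obtain y where y: "y \<in> Units R" "s = y \<otimes> y"
      by (auto simp: S_def)
    have "{x \<in> Units R. x \<otimes> x = s} \<subseteq> {y, \<ominus> y}"
      using square_eq_imp y by blast
    then have "card {x \<in> Units R. x \<otimes> x = s} \<le> card {y, \<ominus> y}"
      by (intro card_mono) auto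
    also have "\<dots> \<le> 2"
      by (simp add: card_insert_le_m1)
    finally show "card {x \<in> Units R. x \<otimes> x = s} \<le> 2" .
  qed
  finally have le: "card (Units R) \<le> 2 * card S"
    by simp
  let ?hS = "(\<lambda>s. h \<otimes> s) ` S" and ?aS = "(\<lambda>s. a \<otimes> s) ` S"
  have nosq: False if "g \<in> Units R" "\<And>s. s \<in> Units R \<Longrightarrow> g \<noteq> s \<otimes> s"
    "g \<otimes> (s \<otimes> s) = t \<otimes> t" "s \<in> Units R" "t \<in> Units R" for g s t
  proof -
    have "g = \<one> \<otimes> ((t \<otimes> inv s) \<otimes> (t \<otimes> inv s))"
      using that by (intro Units_divide_square) auto
    moreover have "t \<otimes> inv s \<in> Units R"
      using that by simp
    ultimately show False
      using that(2)[of "t \<otimes> inv s"] Units_closed l_one m_closed by metis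
  qed
  have "S \<inter> ?hS = {}"
    using nosq[OF h] unfolding S_def by (force simp: disjoint_iff)
  moreover have "S \<inter> ?aS = {}"
    using nosq[OF a] unfolding S_def by (force simp: disjoint_iff)
  moreover have "?hS \<inter> ?aS = {}"
  proof (rule ccontr)
    assume "?hS \<inter> ?aS \<noteq> {}"
    then obtain s t where st: "s \<in> Units R" "t \<in> Units R" "a \<otimes> (s \<otimes> s) = h \<otimes> (t \<otimes> t)"
      unfolding S_def by auto metis
    then have "a = h \<otimes> ((t \<otimes> inv s) \<otimes> (t \<otimes> inv s))"
      using a h by (intro Units_divide_square) auto
    then show False
      using no st by blast
  qed
  ultimately have "card (S \<union> (?hS \<union> ?aS)) = card S + (card ?hS + card ?aS)"
    using finS by (subst card_Un_disjoint; (subst card_Un_disjoint)?) auto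
  also have "\<dots> = 3 * card S"
    using card_image[OF inj[OF h(1)]] card_image[OF inj[OF a(1)]] by simp
  finally have "3 * card S \<le> card (Units R)"
    using card_mono[OF finU, of "S \<union> (?hS \<union> ?aS)"] SU h a by (auto simp: subset_iff)
  moreover have "card S > 0"
    using finS by (auto simp: card_gt_0_iff S_def)
  ultimately show False
    using le by simp
qed

text \<open>The identity behind it is \<open>((1 + a)/2)^2 - ((a - 1)/2)^2 = a\<close>; the
  coefficient \<open>s^2\<close> is removed by scaling \<open>y\<close> with the inverse of
  \<open>s\<close>.\<close>

lemma hyperbolic_represents:
  assumes "s \<in> Units R" "a \<in> carrier R"
  shows "\<exists>x\<in>carrier R. \<exists>y\<in>carrier R. a = x \<otimes> x \<oplus> (\<ominus> (s \<otimes> s)) \<otimes> (y \<otimes> y)"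
proof -
  define k where "k = inv (\<one> \<oplus> \<one>)"
  have c: "s \<in> carrier R" "inv s \<in> carrier R" "k \<in> carrier R"
    using assms two by (auto simp: k_def)
  define x z where "x = k \<otimes> (\<one> \<oplus> a)" and "z = k \<otimes> (a \<ominus> \<one>)"
  have xz: "x \<in> carrier R" "z \<in> carrier R"
    using c assms(2) by (auto simp: x_def z_def)
  have cancel: "p \<otimes> p \<oplus> (\<ominus> (s \<otimes> s)) \<otimes> ((i \<otimes> r) \<otimes> (i \<otimes> r)) = p \<otimes> p \<ominus> (s \<otimes> i) \<otimes> (s \<otimes> i) \<otimes> (r \<otimes> r)"
    if "p \<in> carrier R" "r \<in> carrier R" "i \<in> carrier R" for p r i
    using c(1) that by algebra
  have factor: "(k \<otimes> u) \<otimes> (k \<otimes> u) \<ominus> (k \<otimes> v) \<otimes> (k \<otimes> v) = (k \<otimes> k) \<otimes> (u \<otimes> u \<ominus> v \<otimes> v)"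
    if "u \<in> carrier R" "v \<in> carrier R" for u v
    using c(3) that by algebra
  have "(\<one> \<oplus> a) \<otimes> (\<one> \<oplus> a) \<ominus> (a \<ominus> \<one>) \<otimes> (a \<ominus> \<one>) = (\<one> \<oplus> \<one>) \<otimes> (\<one> \<oplus> \<one>) \<otimes> a"
    using assms(2) by algebra
  then have "x \<otimes> x \<ominus> z \<otimes> z = (k \<otimes> k) \<otimes> ((\<one> \<oplus> \<one>) \<otimes> (\<one> \<oplus> \<one>) \<otimes> a)"
    using assms(2) by (simp add: x_def z_def factor)
  also have "\<dots> = (k \<otimes> (\<one> \<oplus> \<one>)) \<otimes> (k \<otimes> (\<one> \<oplus> \<one>)) \<otimes> a"
    using c(3) assms(2) by algebra
  also have "\<dots> = a"
    using two assms(2) by (simp add: k_def)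
  finally have "a = x \<otimes> x \<oplus> (\<ominus> (s \<otimes> s)) \<otimes> ((inv s \<otimes> z) \<otimes> (inv s \<otimes> z))"
    using assms(1) c xz by (simp add: cancel)
  then show ?thesis
    using c xz by blast
qed

text \<open>If every unit represented by \<open>x\<^sup>2 + n y\<^sup>2\<close> is a square, then the set \<open>Q\<close> of squares of units
  and radical elements is closed under adding \<open>1\<close>; hence \<open>-1\<close> is a square, so is \<open>-n\<close>, and the
  form is hyperbolic. Otherwise it represents a non-square, and the squares have index two.\<close>

lemma unit_represented:
  assumes n: "n \<in> Units R" and a: "a \<in> Units R"
  shows "\<exists>x\<in>carrier R. \<exists>y\<in>carrier R. a = x \<otimes> x \<oplus> n \<otimes> (y \<otimes> y)"
proof (cases "\<exists>h\<in>Units R. (\<exists>x\<in>carrier R. \<exists>y\<in>carrier R. h = x \<otimes> x \<oplus> n \<otimes> (y \<otimes> y)) \<and>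
    (\<forall>s\<in>Units R. h \<noteq> s \<otimes> s)")
  case True
  then obtain h x y where h: "h \<in> Units R" "\<And>s. s \<in> Units R \<Longrightarrow> h \<noteq> s \<otimes> s"
    and xy: "x \<in> carrier R" "y \<in> carrier R" "h = x \<otimes> x \<oplus> n \<otimes> (y \<otimes> y)"
    by blast
  show ?thesis
  proof (cases "\<exists>s\<in>Units R. a = s \<otimes> s")
    case True
    then obtain s where "s \<in> Units R" "a = s \<otimes> s"
      by blast
    then have "a = s \<otimes> s \<oplus> n \<otimes> (\<zero> \<otimes> \<zero>)" "s \<in> carrier R"
      using n[THEN Units_closed] by auto
    then show ?thesis
      using zero_closed by blast
  next
    case False
    then obtain w where w: "w \<in> Units R" "a = h \<otimes> (w \<otimes> w)"
      using nonsquare_quotient[OF h a] by blast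
    have "a = (w \<otimes> x) \<otimes> (w \<otimes> x) \<oplus> n \<otimes> ((w \<otimes> y) \<otimes> (w \<otimes> y))"
      unfolding w(2) xy(3) using w(1)[THEN Units_closed] xy(1,2) n[THEN Units_closed] by algebra
    then show ?thesis
      using w xy by blast
  qed
next
  case False
  then have allsq: "\<exists>s\<in>Units R. h = s \<otimes> s"
    if "h \<in> Units R" "h = x \<otimes> x \<oplus> n \<otimes> (y \<otimes> y)" "x \<in> carrier R" "y \<in> carrier R" for h x y
    using that by blast
  \<comment> \<open>The form takes the value \<open>n\<close> at \<open>(0, 1)\<close>, so
    \<open>n\<close> itself must be a square.\<close>
  have "n = \<zero> \<otimes> \<zero> \<oplus> n \<otimes> (\<one> \<otimes> \<one>)"
    using n[THEN Units_closed] by simp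
  then obtain s where s: "s \<in> Units R" "n = s \<otimes> s"
    using allsq[OF n] by blast
  define Q where "Q = {q \<in> carrier R. (\<exists>x\<in>Units R. q = x \<otimes> x) \<or> q \<in> jacobson}"
  \<comment> \<open>If \<open>q = x^2\<close> is a unit, then \<open>q + 1\<close> is the value of
    the form at \<open>(1, x/s)\<close>: either it is a unit, hence a square by the case assumption,
    or locality puts it into the radical.\<close>
  have step: "q \<oplus> \<one> \<in> Q" if q: "q \<in> Q" for q
  proof (cases "q \<in> jacobson")
    case True
    then obtain r where "r \<in> Units R" "\<one> \<oplus> q = r \<otimes> r"
      using square_add_jacobson[of \<one> q] by auto
    then show ?thesis
      using q by (auto simp: Q_def a_comm)
  next
    case False
    then obtain x where x: "x \<in> Units R" "q = x \<otimes> x"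
      using q by (auto simp: Q_def)
    have c: "x \<in> carrier R" "s \<in> carrier R" "inv s \<in> carrier R"
      using x s by auto
    have "\<one> \<otimes> \<one> \<oplus> n \<otimes> ((inv s \<otimes> x) \<otimes> (inv s \<otimes> x)) = (s \<otimes> inv s) \<otimes> (s \<otimes> inv s) \<otimes> (x \<otimes> x) \<oplus> \<one>"
      unfolding s(2) using c by algebra
    also have "\<dots> = q \<oplus> \<one>"
      using s c x by simp
    finally have "q \<oplus> \<one> = \<one> \<otimes> \<one> \<oplus> n \<otimes> ((inv s \<otimes> x) \<otimes> (inv s \<otimes> x))" ..
    then have "q \<oplus> \<one> \<in> Units R \<Longrightarrow> \<exists>r\<in>Units R. q \<oplus> \<one> = r \<otimes> r"
      using allsq[of "q \<oplus> \<one>" \<one> "inv s \<otimes> x"] c by blast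
    then show ?thesis
      using local[of "q \<oplus> \<one>"] q by (auto simp: Q_def)
  qed
  \<comment> \<open>Adding 1 is an injective self-map of the finite set \<open>Q\<close>, hence
    onto; the preimage of 0 is -1.\<close>
  have "finite Q"
    using fin by (rule finite_subset[rotated]) (auto simp: Q_def)
  then have "(\<lambda>q. q \<oplus> \<one>) ` Q = Q"
    using step by (intro endo_inj_surj) (auto intro!: inj_onI simp: Q_def)
  moreover have "\<zero> \<in> Q"
    by (simp add: Q_def nilpotent_imp_jacobson[of _ 1])
  ultimately obtain q where q: "q \<in> Q" "q \<oplus> \<one> = \<zero>"
    by (metis (no_types, lifting) imageE)
  then have q1: "q = \<ominus> \<one>"
    using sum_zero_eq_neg[of q \<one>] by (auto simp: Q_def)
  then have "q \<in> Units R"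
    by auto
  then obtain c where c: "c \<in> Units R" "q = c \<otimes> c"
    using q(1) Units_not_jacobson by (auto simp: Q_def)
  \<comment> \<open>From \<open>c^2 = -1\<close> and \<open>n = s^2\<close>; it exhibits the form as
    the hyperbolic one with parameter \<open>c s\<close>.\<close>
  have "n = \<ominus> ((c \<otimes> s) \<otimes> (c \<otimes> s))"
  proof -
    have "\<ominus> ((c \<otimes> s) \<otimes> (c \<otimes> s)) = \<ominus> (c \<otimes> c) \<otimes> (s \<otimes> s)"
      using c(1)[THEN Units_closed] s(1)[THEN Units_closed] by algebra
    then show ?thesis
      using s(2) s(1)[THEN Units_closed] by (simp flip: c(2) add: q1)
  qed
  then show ?thesis
    using hyperbolic_represents[of "c \<otimes> s" a] a c s by auto
qed

end

text \<open>Induction on the size of the ring. A nontrivial idempotent splits it into two smaller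
  corners whose solutions can be added; without one the ring is local, where counting squares
  applies.\<close>

lemma odd_unit_represented:
  fixes R :: "('a, 'b) ring_scheme" (structure)
  assumes "cring R" "finite (carrier R)" "\<one> \<oplus> \<one> \<in> Units R" "n \<in> Units R" "a \<in> Units R"
  shows "\<exists>x\<in>carrier R. \<exists>y\<in>carrier R. a = x \<otimes> x \<oplus> n \<otimes> (y \<otimes> y)"
  using assms
proof (induction "card (carrier R)" arbitrary: R n a rule: less_induct)
  case (less R n a)
  interpret cring R by fact
  note fin = \<open>finite (carrier R)\<close>
  have ac: "a \<in> carrier R" and nc: "n \<in> carrier R"
    using less.prems by auto
  consider "\<one>\<^bsub>R\<^esub> = \<zero>\<^bsub>R\<^esub>"
    | e where "\<one>\<^bsub>R\<^esub> \<noteq> \<zero>\<^bsub>R\<^esub>" "e \<in> carrier R" "e \<otimes>\<^bsub>R\<^esub> e = e" "e \<noteq> \<zero>\<^bsub>R\<^esub>" "e \<noteq> \<one>\<^bsub>R\<^esub>"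
    | "\<one>\<^bsub>R\<^esub> \<noteq> \<zero>\<^bsub>R\<^esub>" "\<And>e. e \<in> carrier R \<Longrightarrow> e \<otimes>\<^bsub>R\<^esub> e = e \<Longrightarrow> e = \<zero>\<^bsub>R\<^esub> \<or> e = \<one>\<^bsub>R\<^esub>"
    by blast
  then show ?case
  proof cases
    case 1
    then have "carrier R = {\<zero>\<^bsub>R\<^esub>}"
      by (simp add: carrier_one_zero)
    then show ?thesis
      using ac nc by simp
  next
    case (2 e)
    have part: "\<exists>x\<in>carrier R. \<exists>y\<in>carrier R. f \<otimes>\<^bsub>R\<^esub> x = x \<and> f \<otimes>\<^bsub>R\<^esub> y = y \<and>
        f \<otimes>\<^bsub>R\<^esub> a = x \<otimes>\<^bsub>R\<^esub> x \<oplus>\<^bsub>R\<^esub> n \<otimes>\<^bsub>R\<^esub> (y \<otimes>\<^bsub>R\<^esub> y)"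
      if f: "f \<in> carrier R" "f \<otimes>\<^bsub>R\<^esub> f = f" "f \<noteq> \<one>\<^bsub>R\<^esub>" for f
    proof -
      interpret C: cring "corner R f"
        using f by (intro corner_cring)
      have "f \<otimes>\<^bsub>R\<^esub> \<one>\<^bsub>R\<^esub> = f"
        using f by simp
      then have "\<one>\<^bsub>R\<^esub> \<notin> carrier (corner R f)"
        using f by (simp add: eq_commute[of f])
      moreover have "carrier (corner R f) \<subseteq> carrier R"
        by auto
      ultimately have "carrier (corner R f) \<subset> carrier R"
        using one_closed by blast
      then have card: "card (carrier (corner R f)) < card (carrier R)"
        by (rule psubset_card_mono[OF fin])
      have "f \<oplus>\<^bsub>R\<^esub> f = f \<otimes>\<^bsub>R\<^esub> (\<one>\<^bsub>R\<^esub> \<oplus>\<^bsub>R\<^esub> \<one>\<^bsub>R\<^esub>)"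
        using f by (simp add: r_distr)
      then have two: "\<one>\<^bsub>corner R f\<^esub> \<oplus>\<^bsub>corner R f\<^esub> \<one>\<^bsub>corner R f\<^esub> \<in> Units (corner R f)"
        using Units_corner[OF f(1,2) less.prems(3)] by simp
      have "finite (carrier (corner R f))"
        using fin by simp
      from less.hyps[OF card C.cring_axioms this two Units_corner[OF f(1,2) less.prems(4)]
          Units_corner[OF f(1,2) less.prems(5)]]
      obtain x y where xy: "x \<in> carrier R" "y \<in> carrier R" "f \<otimes>\<^bsub>R\<^esub> x = x" "f \<otimes>\<^bsub>R\<^esub> y = y"
        "f \<otimes>\<^bsub>R\<^esub> a = x \<otimes>\<^bsub>R\<^esub> x \<oplus>\<^bsub>R\<^esub> (f \<otimes>\<^bsub>R\<^esub> n) \<otimes>\<^bsub>R\<^esub> (y \<otimes>\<^bsub>R\<^esub> y)"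
        by auto
      have "(f \<otimes>\<^bsub>R\<^esub> n) \<otimes>\<^bsub>R\<^esub> (y \<otimes>\<^bsub>R\<^esub> y) = n \<otimes>\<^bsub>R\<^esub> ((f \<otimes>\<^bsub>R\<^esub> y) \<otimes>\<^bsub>R\<^esub> y)"
        using f(1) nc xy(2) by algebra
      then show ?thesis
        using xy by metis
    qed
    let ?f = "\<one>\<^bsub>R\<^esub> \<ominus>\<^bsub>R\<^esub> e"
    have ef: "e \<otimes>\<^bsub>R\<^esub> ?f = \<zero>\<^bsub>R\<^esub>"
      using 2 by (simp add: minus_eq r_distr r_minus r_neg)
    have fc: "?f \<in> carrier R" "?f \<noteq> \<one>\<^bsub>R\<^esub>"
      using 2 ef by auto
    have "?f \<otimes>\<^bsub>R\<^esub> ?f = ?f \<ominus>\<^bsub>R\<^esub> e \<otimes>\<^bsub>R\<^esub> ?f"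
      using 2(2) by algebra
    then have ff: "?f \<otimes>\<^bsub>R\<^esub> ?f = ?f"
      using ef fc by (simp add: minus_eq)
    obtain x y where xy: "x \<in> carrier R" "y \<in> carrier R" "e \<otimes>\<^bsub>R\<^esub> x = x" "e \<otimes>\<^bsub>R\<^esub> y = y"
      "e \<otimes>\<^bsub>R\<^esub> a = x \<otimes>\<^bsub>R\<^esub> x \<oplus>\<^bsub>R\<^esub> n \<otimes>\<^bsub>R\<^esub> (y \<otimes>\<^bsub>R\<^esub> y)"
      using part[of e] 2 by blast
    obtain z w where zw: "z \<in> carrier R" "w \<in> carrier R" "?f \<otimes>\<^bsub>R\<^esub> z = z" "?f \<otimes>\<^bsub>R\<^esub> w = w"
      "?f \<otimes>\<^bsub>R\<^esub> a = z \<otimes>\<^bsub>R\<^esub> z \<oplus>\<^bsub>R\<^esub> n \<otimes>\<^bsub>R\<^esub> (w \<otimes>\<^bsub>R\<^esub> w)"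
      using part[of ?f] fc ff by blast
    \<comment> \<open>Products across the two corners vanish, so adding the two solutions creates no
      mixed terms.\<close>
    have orth: "r \<otimes>\<^bsub>R\<^esub> s = \<zero>\<^bsub>R\<^esub>"
      if "r \<in> carrier R" "s \<in> carrier R" "e \<otimes>\<^bsub>R\<^esub> r = r" "?f \<otimes>\<^bsub>R\<^esub> s = s" for r s
    proof -
      have "(e \<otimes>\<^bsub>R\<^esub> r) \<otimes>\<^bsub>R\<^esub> (?f \<otimes>\<^bsub>R\<^esub> s) = (e \<otimes>\<^bsub>R\<^esub> ?f) \<otimes>\<^bsub>R\<^esub> (r \<otimes>\<^bsub>R\<^esub> s)"
        using that(1,2) 2(2) by algebra
      then show ?thesis
        using that ef by simp
    qed
    have xz: "x \<otimes>\<^bsub>R\<^esub> z = \<zero>\<^bsub>R\<^esub>" and yw: "y \<otimes>\<^bsub>R\<^esub> w = \<zero>\<^bsub>R\<^esub>"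
      using orth xy(1-4) zw(1-4) by blast+
    have "(x \<oplus>\<^bsub>R\<^esub> z) \<otimes>\<^bsub>R\<^esub> (x \<oplus>\<^bsub>R\<^esub> z) \<oplus>\<^bsub>R\<^esub> n \<otimes>\<^bsub>R\<^esub> ((y \<oplus>\<^bsub>R\<^esub> w) \<otimes>\<^bsub>R\<^esub> (y \<oplus>\<^bsub>R\<^esub> w)) =
        (x \<otimes>\<^bsub>R\<^esub> x \<oplus>\<^bsub>R\<^esub> n \<otimes>\<^bsub>R\<^esub> (y \<otimes>\<^bsub>R\<^esub> y)) \<oplus>\<^bsub>R\<^esub> (z \<otimes>\<^bsub>R\<^esub> z \<oplus>\<^bsub>R\<^esub> n \<otimes>\<^bsub>R\<^esub> (w \<otimes>\<^bsub>R\<^esub> w)) \<oplus>\<^bsub>R\<^esub>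
        (x \<otimes>\<^bsub>R\<^esub> z \<oplus>\<^bsub>R\<^esub> x \<otimes>\<^bsub>R\<^esub> z \<oplus>\<^bsub>R\<^esub> n \<otimes>\<^bsub>R\<^esub> (y \<otimes>\<^bsub>R\<^esub> w \<oplus>\<^bsub>R\<^esub> y \<otimes>\<^bsub>R\<^esub> w))"
      using xy(1,2) zw(1,2) nc by algebra
    also have "\<dots> = e \<otimes>\<^bsub>R\<^esub> a \<oplus>\<^bsub>R\<^esub> ?f \<otimes>\<^bsub>R\<^esub> a"
      unfolding xy(5)[symmetric] zw(5)[symmetric] xz yw using nc ac fc(1) 2(2) by simp
    also have "\<dots> = a"
      using 2(2) ac by algebra
    finally show ?thesis
      using xy(1,2) zw(1,2) by (metis a_closed)
  next
    case 3
    \<comment> \<open>Some positive power of \<open>x\<close> is idempotent, hence 0 or 1.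
      Accordingly \<open>x\<close> is nilpotent, so in the radical, or a unit.\<close>
    have "x \<in> Units R \<or> x \<in> jacobson" if x: "x \<in> carrier R" for x
    proof -
      have "range (\<lambda>k::nat. x [^]\<^bsub>R\<^esub> k) \<subseteq> carrier R"
        using x by auto
      then have "finite (range (\<lambda>k::nat. x [^]\<^bsub>R\<^esub> k))"
        using fin finite_subset by blast
      moreover have "x [^]\<^bsub>R\<^esub> (i + k) = x [^]\<^bsub>R\<^esub> (j + k)" if "x [^]\<^bsub>R\<^esub> i = x [^]\<^bsub>R\<^esub> j" for i j k :: nat
        using that x by (metis nat_pow_mult)
      ultimately obtain N :: nat where N: "N \<ge> 1" "x [^]\<^bsub>R\<^esub> (N + N) = x [^]\<^bsub>R\<^esub> N"
        using finite_range_idempotent_index[of "\<lambda>k::nat. x [^]\<^bsub>R\<^esub> k"] by blast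
      then have "x [^]\<^bsub>R\<^esub> N = \<zero>\<^bsub>R\<^esub> \<or> x [^]\<^bsub>R\<^esub> N = \<one>\<^bsub>R\<^esub>"
        using x by (intro 3) (auto simp: nat_pow_mult)
      then show ?thesis
      proof
        assume "x [^]\<^bsub>R\<^esub> N = \<one>\<^bsub>R\<^esub>"
        moreover have "x [^]\<^bsub>R\<^esub> N = x [^]\<^bsub>R\<^esub> (N - 1) \<otimes>\<^bsub>R\<^esub> x"
          using N(1) by (metis Suc_diff_1 less_le_trans nat_pow_Suc zero_less_one)
        ultimately have "x [^]\<^bsub>R\<^esub> (N - 1) \<otimes>\<^bsub>R\<^esub> x = \<one>\<^bsub>R\<^esub>" "x \<otimes>\<^bsub>R\<^esub> x [^]\<^bsub>R\<^esub> (N - 1) = \<one>\<^bsub>R\<^esub>"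
          using x by (auto simp: m_comm)
        then have "x \<in> Units R"
          using x unfolding Units_def by blast
        then show ?thesis ..
      qed (use nilpotent_imp_jacobson x in blast)
    qed
    then interpret finite_odd_local_cring R
      using 3 fin less.prems by unfold_locales auto
    show ?thesis
      using unit_represented less.prems by blast
  qed
qed

section \<open>Norms from self-adjoint operators\<close>

text \<open>Only additivity is recorded, so that one argument about adjoints serves bilinear and
  hermitian forms alike; scalars return as operators in a centralizer.\<close>

definition biadditive :: "('v::ab_group_add \<Rightarrow> 'w::ab_group_add \<Rightarrow> 'k::ab_group_add) \<Rightarrow> bool" where
  "biadditive \<beta> \<longleftrightarrow> (\<forall>v. additive (\<lambda>u. \<beta> u v)) \<and> (\<forall>u. additive (\<beta> u))"

lemma biadditive_simps:
  assumes "biadditive \<beta>"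
  shows "\<beta> (u + v) w = \<beta> u w + \<beta> v w" "\<beta> u (w + x) = \<beta> u w + \<beta> u x"
    "\<beta> (u - v) w = \<beta> u w - \<beta> v w" "\<beta> u (w - x) = \<beta> u w - \<beta> u x"
    "\<beta> (- u) w = - \<beta> u w" "\<beta> u (- w) = - \<beta> u w" "\<beta> 0 w = 0" "\<beta> u 0 = 0"
proof -
  interpret l: additive "\<lambda>u. \<beta> u w" for w
    using assms by (simp add: biadditive_def)
  interpret r: additive "\<beta> u" for u
    using assms by (simp add: biadditive_def)
  show "\<beta> (u + v) w = \<beta> u w + \<beta> v w" "\<beta> u (w + x) = \<beta> u w + \<beta> u x"
    "\<beta> (u - v) w = \<beta> u w - \<beta> v w" "\<beta> u (w - x) = \<beta> u w - \<beta> u x"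
    "\<beta> (- u) w = - \<beta> u w" "\<beta> u (- w) = - \<beta> u w" "\<beta> 0 w = 0" "\<beta> u 0 = 0"
    by (simp_all add: l.add r.add l.diff r.diff l.minus r.minus l.zero r.zero)
qed

lemma additive_simps:
  assumes "additive f"
  shows "f (x + y) = f x + f y" "f 0 = 0" "f (- x) = - f x" "f (x - y) = f x - f y"
  using assms additive.add additive.zero additive.minus additive.diff by metis+

lemma finite_UNIV_fun:
  assumes "finite (UNIV :: 'a set)" "finite (UNIV :: 'b set)"
  shows "finite (UNIV :: ('a \<Rightarrow> 'b) set)"
  using finite_set_of_finite_funs[OF assms] by simp

section \<open>Commutative rings of self-adjoint operators\<close>

definition centralizer :: "('v::ab_group_add \<Rightarrow> 'v) set \<Rightarrow> ('v \<Rightarrow> 'v) set" where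
  "centralizer S = {Z. additive Z \<and> (\<forall>Y\<in>S. \<forall>v. Z (Y v) = Y (Z v))}"

lemma centralizerD:
  assumes "Z \<in> centralizer S"
  shows "additive Z" "Y \<in> S \<Longrightarrow> Z (Y v) = Y (Z v)"
  using assms by (auto simp: centralizer_def)

lemma centralizer_subset: "S \<subseteq> centralizer S \<Longrightarrow> centralizer (centralizer S) \<subseteq> centralizer S"
  by (auto simp: centralizer_def)

text \<open>For a commuting set \<open>S\<close> the double commutant is commutative, and this makes
  products of self-adjoint members self-adjoint. The idempotent \<open>e\<close> serves as identity,
  so the ring acts on the range of \<open>e\<close> and kills its kernel.\<close>

definition selfadjoint_ring ::
  "('v::ab_group_add \<Rightarrow> 'v \<Rightarrow> 'k) \<Rightarrow> ('v \<Rightarrow> 'v) set \<Rightarrow> ('v \<Rightarrow> 'v) \<Rightarrow> ('v \<Rightarrow> 'v) ring" where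
  "selfadjoint_ring \<beta> S e =
    \<lparr>carrier = {Y \<in> centralizer (centralizer S). (\<forall>u v. \<beta> (Y u) v = \<beta> u (Y v)) \<and> (\<forall>v. Y (e v) = Y v)},
     monoid.mult = (\<lambda>Y Z v. Y (Z v)), one = e, zero = (\<lambda>_. 0), add = (\<lambda>Y Z v. Y v + Z v)\<rparr>"

lemma selfadjoint_ring_simps [simp]:
  "\<one>\<^bsub>selfadjoint_ring \<beta> S e\<^esub> = e" "\<zero>\<^bsub>selfadjoint_ring \<beta> S e\<^esub> = (\<lambda>_. 0)"
  "Y \<otimes>\<^bsub>selfadjoint_ring \<beta> S e\<^esub> Z = (\<lambda>v. Y (Z v))"
  "Y \<oplus>\<^bsub>selfadjoint_ring \<beta> S e\<^esub> Z = (\<lambda>v. Y v + Z v)"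
  by (simp_all add: selfadjoint_ring_def)

context
  fixes \<beta> :: "'v::ab_group_add \<Rightarrow> 'v \<Rightarrow> 'k::ab_group_add"
    and S :: "('v \<Rightarrow> 'v) set" and e :: "'v \<Rightarrow> 'v"
  assumes fin: "finite (UNIV :: 'v set)"
    and \<beta>: "biadditive \<beta>"
    and S: "S \<subseteq> centralizer S"
    and e: "e \<in> S" "\<And>v. e (e v) = e v" "\<And>u v. \<beta> (e u) v = \<beta> u (e v)"
begin

lemma selfadjoint_ringD:
  assumes "Y \<in> carrier (selfadjoint_ring \<beta> S e)"
  shows "additive Y" "Z \<in> centralizer S \<Longrightarrow> Y (Z v) = Z (Y v)" "\<beta> (Y u) v = \<beta> u (Y v)"
    "Y (e v) = Y v" "e (Y v) = Y v" "Z \<in> S \<Longrightarrow> Y (Z v) = Z (Y v)"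
    "Z \<in> carrier (selfadjoint_ring \<beta> S e) \<Longrightarrow> Y (Z v) = Z (Y v)"
proof -
  note Y = assms[unfolded selfadjoint_ring_def, simplified]
  show "additive Y"
    using Y centralizerD(1) by blast
  show Z: "Y (Z v) = Z (Y v)" if "Z \<in> centralizer S" for Z v
    using Y that centralizerD(2) by blast
  show "\<beta> (Y u) v = \<beta> u (Y v)" "Y (e v) = Y v" for u v
    using Y by auto
  show ZS: "Y (Z v) = Z (Y v)" if "Z \<in> S" for Z v
    using Z S that by blast
  show "e (Y v) = Y v" for v
    using ZS[OF e(1), of v] Y by simp
  show "Y (Z v) = Z (Y v)" if "Z \<in> carrier (selfadjoint_ring \<beta> S e)"
    using that centralizer_subset[OF S] by (intro Z) (auto simp: selfadjoint_ring_def)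
qed

lemma selfadjoint_ringI:
  assumes "additive Y" "\<And>Z v. Z \<in> centralizer S \<Longrightarrow> Y (Z v) = Z (Y v)"
    "\<And>u v. \<beta> (Y u) v = \<beta> u (Y v)" "\<And>v. Y (e v) = Y v"
  shows "Y \<in> carrier (selfadjoint_ring \<beta> S e)"
  using assms by (auto simp: selfadjoint_ring_def centralizer_def[of "centralizer S"])

lemma cring_selfadjoint_ring: "cring (selfadjoint_ring \<beta> S e)"
proof (rule cringI)
  let ?R = "selfadjoint_ring \<beta> S e"
  note D = selfadjoint_ringD and cD = centralizerD
  show "abelian_group ?R"
  proof (rule abelian_groupI)
    fix Y Z assume YZ: "Y \<in> carrier ?R" "Z \<in> carrier ?R"
    show "Y \<oplus>\<^bsub>?R\<^esub> Z \<in> carrier ?R"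
    proof (rule selfadjoint_ringI)
      show "additive (Y \<oplus>\<^bsub>?R\<^esub> Z)"
        using YZ[THEN D(1)] by (simp add: additive_def)
      show "(Y \<oplus>\<^bsub>?R\<^esub> Z) (P v) = P ((Y \<oplus>\<^bsub>?R\<^esub> Z) v)" if P: "P \<in> centralizer S" for P v
        using D(2)[OF YZ(1) P] D(2)[OF YZ(2) P] cD(1)[OF P] by (simp add: additive_simps)
    qed (simp_all add: biadditive_simps[OF \<beta>] D(3,4)[OF YZ(1)] D(3,4)[OF YZ(2)])
  next
    show "\<zero>\<^bsub>?R\<^esub> \<in> carrier ?R"
    proof (rule selfadjoint_ringI)
      show "\<zero>\<^bsub>?R\<^esub> (P v) = P (\<zero>\<^bsub>?R\<^esub> v)" if "P \<in> centralizer S" for P v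
        using cD(1)[OF that] by (simp add: additive_simps)
    qed (simp_all add: biadditive_simps[OF \<beta>] additive_def)
  next
    fix Y assume Y: "Y \<in> carrier ?R"
    have "(\<lambda>v. - Y v) \<in> carrier ?R"
    proof (rule selfadjoint_ringI)
      show "additive (\<lambda>v. - Y v)"
        using D(1)[OF Y] by (simp add: additive_def)
      show "- Y (P v) = P (- Y v)" if P: "P \<in> centralizer S" for P v
        using D(2)[OF Y P] cD(1)[OF P] by (simp add: additive_simps)
    qed (simp_all add: biadditive_simps[OF \<beta>] D(3,4)[OF Y])
    then show "\<exists>Z\<in>carrier ?R. Z \<oplus>\<^bsub>?R\<^esub> Y = \<zero>\<^bsub>?R\<^esub>"
      by force
  qed (auto simp: add_ac)
  show "comm_monoid ?R"
  proof (rule comm_monoidI)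
    fix Y Z assume YZ: "Y \<in> carrier ?R" "Z \<in> carrier ?R"
    show "Y \<otimes>\<^bsub>?R\<^esub> Z \<in> carrier ?R"
    proof (rule selfadjoint_ringI)
      show "additive (Y \<otimes>\<^bsub>?R\<^esub> Z)"
        using YZ[THEN D(1)] by (simp add: additive_def)
      show "\<beta> ((Y \<otimes>\<^bsub>?R\<^esub> Z) u) v = \<beta> u ((Y \<otimes>\<^bsub>?R\<^esub> Z) v)" for u v
        using D(3)[OF YZ(1)] D(3)[OF YZ(2)] D(7)[OF YZ] by simp
    qed (simp_all add: D(2,4)[OF YZ(1)] D(2,4)[OF YZ(2)])
    show "Y \<otimes>\<^bsub>?R\<^esub> Z = Z \<otimes>\<^bsub>?R\<^esub> Y"
      using D(7)[OF YZ] by auto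
  next
    show "\<one>\<^bsub>?R\<^esub> \<in> carrier ?R"
    proof (rule selfadjoint_ringI)
      show "additive \<one>\<^bsub>?R\<^esub>"
        using e(1) S by (auto simp: centralizer_def)
      show "\<one>\<^bsub>?R\<^esub> (Z v) = Z (\<one>\<^bsub>?R\<^esub> v)" if "Z \<in> centralizer S" for Z v
        using cD(2)[OF that e(1)] by simp
    qed (simp_all add: e(2,3))
  qed (use D(5) in auto)
qed (use selfadjoint_ringD(1) in \<open>auto simp: additive_simps\<close>)

lemma finite_selfadjoint_ring: "finite (carrier (selfadjoint_ring \<beta> S e))"
  using finite_UNIV_fun[OF fin fin] finite_subset subset_UNIV by blast

text \<open>Members of the ring take values in the range of \<open>e\<close>, so injectivity of
  \<open>Y\<close> there makes \<open>Y\<close> cancellable. By finiteness it is then a unit, and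
  the inverse is found inside the ring with no check of adjoints or commutation.\<close>

lemma selfadjoint_ring_UnitsI:
  assumes Y: "Y \<in> carrier (selfadjoint_ring \<beta> S e)"
    and inj: "\<And>v. e v = v \<Longrightarrow> Y v = 0 \<Longrightarrow> v = 0"
  shows "Y \<in> Units (selfadjoint_ring \<beta> S e)"
proof -
  interpret cring "selfadjoint_ring \<beta> S e"
    by (rule cring_selfadjoint_ring)
  show ?thesis
  proof (rule Units_if_inj_mult[OF finite_selfadjoint_ring Y], rule inj_onI, rule ext)
    fix P Q v
    assume PQ: "P \<in> carrier (selfadjoint_ring \<beta> S e)" "Q \<in> carrier (selfadjoint_ring \<beta> S e)"
      and "Y \<otimes>\<^bsub>selfadjoint_ring \<beta> S e\<^esub> P = Y \<otimes>\<^bsub>selfadjoint_ring \<beta> S e\<^esub> Q"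
    then have "Y (P v - Q v) = 0"
      using selfadjoint_ringD(1)[OF Y] by (simp add: additive_simps fun_eq_iff)
    moreover have "e (P v - Q v) = P v - Q v"
      using PQ[THEN selfadjoint_ringD(5)] S e(1)
      by (subst additive_simps(4)) (auto simp: centralizer_def)
    ultimately show "P v = Q v"
      using inj by fastforce
  qed
qed

end

text \<open>If \<open>b = x + y W\<close> with \<open>x\<close>, \<open>y\<close> self-adjoint and commuting with \<open>W\<close>, then the adjoint of
  \<open>b\<close> is \<open>x + y W'\<close>, so solving \<open>b\<^sup>* b = A\<close> amounts to representing \<open>A\<close> by the binary quadratic
  form \<open>x\<^sup>2 + t x y + n y\<^sup>2\<close> with \<open>t = W + W'\<close> and \<open>n = W W'\<close>.\<close>

lemma selfadjoint_is_norm: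
  fixes \<beta> :: "'v::ab_group_add \<Rightarrow> 'v \<Rightarrow> 'k::ab_group_add"
  assumes fin: "finite (UNIV :: 'v set)" and \<beta>: "biadditive \<beta>"
    and S: "{W, W', A, e} \<subseteq> centralizer {W, W', A, e}"
    and adj: "\<And>u v. \<beta> (W u) v = \<beta> u (W' v)" "\<And>u v. \<beta> (W' u) v = \<beta> u (W v)"
      "\<And>u v. \<beta> (A u) v = \<beta> u (A v)" "\<And>u v. \<beta> (e u) v = \<beta> u (e v)"
    and e: "\<And>v. e (e v) = e v"
    and A: "\<And>v. e v = v \<Longrightarrow> A v = 0 \<Longrightarrow> v = 0"
    and W: "(\<forall>v::'v. v + v = 0) \<and> (\<forall>v. e v = v \<longrightarrow> W v + W' v = 0 \<longrightarrow> v = 0) \<or>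
      (\<forall>v::'v. v + v = 0 \<longrightarrow> v = 0) \<and> (\<forall>v. W' v = - W v) \<and> (\<forall>v. e v = v \<longrightarrow> W v = 0 \<longrightarrow> v = 0)"
  shows "\<exists>b. additive b \<and> (\<forall>Z\<in>centralizer {W, W', A, e}. \<forall>v. b (Z v) = Z (b v)) \<and>
    (\<forall>u v. \<beta> (b u) (b v) = \<beta> (A (e u)) v)"
proof -
  let ?S = "{W, W', A, e}"
  let ?R = "selfadjoint_ring \<beta> ?S e"
  have eS: "e \<in> ?S" by simp
  note D = selfadjoint_ringD[OF fin \<beta> S eS e adj(4)]
  note I = selfadjoint_ringI[OF fin \<beta> S eS e adj(4)]
  note U = selfadjoint_ring_UnitsI[OF fin \<beta> S eS e adj(4)]
  interpret R: cring ?R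
    by (rule cring_selfadjoint_ring[OF fin \<beta> S eS e adj(4)])
  have finR: "finite (carrier ?R)"
    by (rule finite_selfadjoint_ring[OF fin \<beta> S eS e adj(4)])
  have add: "additive W" "additive W'" "additive A" "additive e"
    using S centralizerD(1) by auto
  have comm: "P (Q v) = Q (P v)" if "P \<in> ?S" "Q \<in> ?S" for P Q v
    using S that centralizerD(2) by blast
  note W'W = comm[of W' W, simplified]
  note eW = comm[of e W, simplified] comm[of e W', simplified] comm[of e A, simplified]
  note cZ = centralizerD(2)[where S = ?S]
  \<comment> \<open>Trace, norm and target are all composed with \<open>e\<close> so that they
    belong to the ring with identity \<open>e\<close>.\<close>
  define t n a where "t = (\<lambda>v. W (e v) + W' (e v))" and "n = (\<lambda>v. W (W' (e v)))"
    and "a = (\<lambda>v. A (e v))"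
  have t: "t \<in> carrier ?R" unfolding t_def
  proof (rule I)
    show "additive (\<lambda>v. W (e v) + W' (e v))"
      using add by (simp add: additive_def)
    show "W (e (Z v)) + W' (e (Z v)) = Z (W (e v) + W' (e v))" if Z: "Z \<in> centralizer ?S" for Z v
      using cZ[OF Z] centralizerD(1)[OF Z] by (simp add: additive_simps)
  qed (simp_all add: biadditive_simps[OF \<beta>] adj e add_ac flip: eW)
  have n: "n \<in> carrier ?R" unfolding n_def
  proof (rule I)
    show "additive (\<lambda>v. W (W' (e v)))"
      using add by (simp add: additive_def)
    show "W (W' (e (Z v))) = Z (W (W' (e v)))" if Z: "Z \<in> centralizer ?S" for Z v
      using cZ[OF Z] by simp
  qed (simp_all add: adj e W'W flip: eW)
  have a: "a \<in> carrier ?R" unfolding a_def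
  proof (rule I)
    show "additive (\<lambda>v. A (e v))"
      using add by (simp add: additive_def)
    show "A (e (Z v)) = Z (A (e v))" if Z: "Z \<in> centralizer ?S" for Z v
      using cZ[OF Z] by simp
  qed (simp_all add: adj e flip: eW)
  have aU: "a \<in> Units ?R"
    using a A by (intro U) (auto simp: a_def)
  \<comment> \<open>In characteristic two the unit is the cross coefficient \<open>t\<close>. In the
    other case \<open>W' = - W\<close>, so \<open>t = 0\<close>, and the unit is \<open>n\<close>,
    which is minus the square of \<open>W\<close> on the range of \<open>e\<close>.\<close>
  have "\<exists>x\<in>carrier ?R. \<exists>y\<in>carrier ?R. a = x \<otimes>\<^bsub>?R\<^esub> x \<oplus>\<^bsub>?R\<^esub> t \<otimes>\<^bsub>?R\<^esub> (x \<otimes>\<^bsub>?R\<^esub> y) \<oplus>\<^bsub>?R\<^esub> n \<otimes>\<^bsub>?R\<^esub> (y \<otimes>\<^bsub>?R\<^esub> y)"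
    using W
  proof (elim disjE conjE)
    assume two: "\<forall>v::'v. v + v = 0" and inj: "\<forall>v. e v = v \<longrightarrow> W v + W' v = 0 \<longrightarrow> v = 0"
    have "t \<in> Units ?R"
      by (rule U[OF t]) (use inj in \<open>simp add: t_def\<close>)
    moreover have "\<one>\<^bsub>?R\<^esub> \<oplus>\<^bsub>?R\<^esub> \<one>\<^bsub>?R\<^esub> = \<zero>\<^bsub>?R\<^esub>"
      by (simp only: selfadjoint_ring_simps two)
    ultimately show ?thesis
      by (intro R.char2_unit_represented[OF finR _ _ n aU])
  next
    assume two: "\<forall>v::'v. v + v = 0 \<longrightarrow> v = 0" and W': "\<forall>v. W' v = - W v"
      and inj: "\<forall>v. e v = v \<longrightarrow> W v = 0 \<longrightarrow> v = 0"
    have "\<one>\<^bsub>?R\<^esub> \<oplus>\<^bsub>?R\<^esub> \<one>\<^bsub>?R\<^esub> \<in> Units ?R"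
    proof (rule U[OF R.a_closed[OF R.one_closed R.one_closed]])
      fix v assume "e v = v" "(\<one>\<^bsub>?R\<^esub> \<oplus>\<^bsub>?R\<^esub> \<one>\<^bsub>?R\<^esub>) v = 0"
      then show "v = 0"
        using two[THEN spec, of v] by simp
    qed
    moreover have "n \<in> Units ?R"
    proof (rule U[OF n])
      fix v assume v: "e v = v" "n v = 0"
      then have "W (W v) = 0"
        using W' additive_simps(3)[OF add(1)] by (simp add: n_def)
      moreover have "e (W v) = W v"
        using eW(1)[of v] v(1) by simp
      ultimately show "v = 0"
        using inj v(1) by blast
    qed
    ultimately obtain x y where xy: "x \<in> carrier ?R" "y \<in> carrier ?R"
      "a = x \<otimes>\<^bsub>?R\<^esub> x \<oplus>\<^bsub>?R\<^esub> n \<otimes>\<^bsub>?R\<^esub> (y \<otimes>\<^bsub>?R\<^esub> y)"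
      using odd_unit_represented[OF R.cring_axioms finR _ _ aU] by blast
    moreover have "t v = 0" for v
      using W' by (simp add: t_def)
    ultimately show ?thesis
      by (intro bexI[of _ x] bexI[of _ y]) simp_all
  qed
  then obtain x y where x: "x \<in> carrier ?R" and y: "y \<in> carrier ?R"
    and rep: "\<And>v. A (e v) = x (x v) + t (x (y v)) + n (y (y v))"
    by (auto simp: a_def fun_eq_iff)
  define b where "b v = x v + y (W v)" for v
  have xadd: "additive x" and yadd: "additive y"
    using D(1) x y by auto
  have "additive b"
    using xadd yadd add by (simp add: additive_def b_def)
  moreover have "b (Z v) = Z (b v)" if "Z \<in> centralizer ?S" for Z v
    using D(2)[OF x that] D(2)[OF y that] cZ[OF that, of W, symmetric] centralizerD(1)[OF that]
    by (simp add: b_def additive_simps)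
  moreover have "\<beta> (b u) (b v) = \<beta> (A (e u)) v" for u v
  proof -
    have "\<beta> (b u) (b v) = \<beta> (b u) (x v) + \<beta> (b u) (y (W v))"
      by (simp add: b_def biadditive_simps[OF \<beta>])
    also have "\<dots> = \<beta> (x (b u) + W' (y (b u))) v"
      using D(3)[OF x] D(3)[OF y] adj(2) by (simp add: biadditive_simps[OF \<beta>])
    also have "x (b u) + W' (y (b u)) = A (e u)"
    proof -
      have xy: "y (x w) = x (y w)" for w
        using D(7)[OF y x] .
      have c: "x (W w) = W (x w)" "x (W' w) = W' (x w)" "y (W w) = W (y w)" "y (W' w) = W' (y w)" for w
        using D(6)[OF x] D(6)[OF y] by simp_all
      have ex: "e (x w) = x w" "e (y w) = y w" for w
        using D(5) x y by auto
      show ?thesis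
        using xadd yadd add by (simp add: rep t_def n_def b_def additive_simps c ex xy W'W add_ac)
    qed
    finally show ?thesis .
  qed
  ultimately show ?thesis
    by blast
qed

section \<open>Finite fields and finite vector spaces\<close>

lemma prime_CHAR_finite_field: "prime CHAR('f::{field,finite})"
  using prime_CHAR_semidom[where ?'a = 'f] finite_imp_CHAR_pos[where ?'a = 'f] by simp

text \<open>Sylow's theorem is used as Cauchy's theorem: the additive group has a nonzero
  \<open>x\<close> with \<open>r x = 0\<close>, so \<open>r\<close> vanishes in the field.\<close>

lemma prime_dvd_card_finite_field:
  assumes "prime r" "r dvd CARD('f::{field,finite})"
  shows "r = CHAR('f)"
proof -
  define G :: "'f monoid" where "G = \<lparr>carrier = UNIV, monoid.mult = (+), one = 0\<rparr>"
  interpret G: group G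
    by (rule groupI) (auto simp: G_def add.assoc intro: exI[of _ "- _"])
  obtain m where "Coset.order G = r ^ 1 * m"
    using assms(2) by (auto simp: Coset.order_def G_def)
  then obtain H where H: "subgroup H G" "card H = r ^ 1"
    using sylow_thm[OF assms(1) G.is_group, of 1 m] finite[of "carrier G"] by blast
  have "card H > 1"
    using H(2) assms(1) prime_gt_1_nat by simp
  then obtain x where x: "x \<in> H" "x \<noteq> 0"
    by (metis card_le_Suc0_iff_eq card_gt_0_iff One_nat_def less_trans not_less zero_less_one)
  interpret H: group "G\<lparr>carrier := H\<rparr>"
    by (rule G.subgroup_imp_group[OF H(1)])
  have "x [^]\<^bsub>G\<lparr>carrier := H\<rparr>\<^esub> Coset.order (G\<lparr>carrier := H\<rparr>) = \<one>\<^bsub>G\<lparr>carrier := H\<rparr>\<^esub>"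
    using x(1) by (intro H.pow_order_eq_1) simp
  then have "x [^]\<^bsub>G\<^esub> r = 0"
    using H(2) by (simp add: Coset.order_def flip: G.nat_pow_consistent) (simp add: G_def)
  moreover have "x [^]\<^bsub>G\<^esub> k = of_nat k * x" for k :: nat
    by (induction k) (simp_all add: G_def nat_pow_def algebra_simps)
  ultimately have "of_nat r = (0 :: 'f)"
    using x(2) by simp
  then have "CHAR('f) dvd r"
    by (simp add: of_nat_eq_0_iff_char_dvd)
  then show ?thesis
    using assms(1) prime_CHAR_finite_field primes_dvd_imp_eq by metis
qed

lemma prime_power_if_unique_prime_divisor:
  assumes "q > 0" "\<And>r. prime r \<Longrightarrow> r dvd q \<Longrightarrow> r = (p::nat)"
  shows "\<exists>n. q = p ^ n"
  using assms
proof (induction q rule: less_induct)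
  case (less q)
  show ?case
  proof (cases "q = 1")
    case True
    then show ?thesis
      by (intro exI[of _ 0]) simp
  next
    case False
    then obtain r where r: "prime r" "r dvd q"
      using prime_factor_nat by blast
    then obtain m where m: "q = p * m"
      using less.prems(2) by (metis dvdE)
    have "p > 1"
      using r less.prems(2) prime_gt_1_nat by blast
    then have "m < q" "m > 0"
      using m less.prems(1) by auto
    then obtain n where "m = p ^ n"
      using less.IH[of m] less.prems(2) m by auto
    then show ?thesis
      using m by (intro exI[of _ "Suc n"]) simp
  qed
qed

lemma card_UNIV_gt_1: "CARD('f::{zero_neq_one,finite}) > 1"
  using card_mono[of "UNIV :: 'f set" "{0, 1}"] by simp

text \<open>Every prime divisor of \<open>q\<close> divides the size of the field, so
  \<open>q\<close> is a power of the characteristic and \<open>x ^ q\<close> an iterated Frobenius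
  map. The case \<open>k = 2\<close> makes the conjugation of a hermitian form additive.\<close>

lemma additive_power_finite_field:
  assumes "q ^ k = CARD('f::{field,finite})"
  shows "(x + y :: 'f) ^ q = x ^ q + y ^ q"
proof -
  let ?p = "CHAR('f)"
  have "k > 0"
    using assms card_UNIV_gt_1 by (cases k) auto
  have "r = ?p" if "prime r" "r dvd q" for r
    using that assms \<open>k > 0\<close> by (metis dvd_power dvd_trans prime_dvd_card_finite_field)
  moreover have "q > 0"
    using assms \<open>k > 0\<close> by (metis finite_UNIV_card_ge_0 finite gr0I zero_power less_irrefl)
  ultimately obtain n where "q = ?p ^ n"
    using prime_power_if_unique_prime_divisor by blast
  then show ?thesis
    using freshmans_dream'[OF prime_CHAR_finite_field] by blast
qed

text \<open>The polynomial \<open>x^q - x\<close> has at most \<open>q\<close> roots. This supplies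
  the scalar moved by the conjugation.\<close>

lemma power_not_identity_finite_field:
  assumes "q < CARD('f::{field,finite})" "q > 1"
  shows "\<exists>u::'f. u ^ q \<noteq> u"
proof (rule ccontr)
  assume "\<not> ?thesis"
  then have roots: "{u. poly (monom 1 q - monom 1 1 :: 'f poly) u = 0} = UNIV"
    by (auto simp: poly_monom)
  have "coeff (monom 1 q - monom 1 1 :: 'f poly) q = 1"
    using assms(2) by simp
  then have "(monom 1 q - monom 1 1 :: 'f poly) \<noteq> 0"
    by (metis coeff_0 zero_neq_one)
  then have "CARD('f) \<le> degree (monom 1 q - monom 1 1 :: 'f poly)"
    using card_poly_roots_bound roots by metis
  also have "\<dots> \<le> q"
    using assms(2) by (intro degree_diff_le) (simp_all add: degree_monom_eq)
  finally show False
    using assms(1) by simp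
qed

lemma finite_UNIV_vector_space:
  fixes scale :: "'f::{field,finite} \<Rightarrow> 'v::ab_group_add \<Rightarrow> 'v"
  assumes "finite_dimensional_vector_space scale Basis"
  shows "finite (UNIV :: 'v set)"
proof -
  interpret finite_dimensional_vector_space scale Basis
    by fact
  have "v \<in> (\<lambda>c. \<Sum>b\<in>Basis. scale (c b) b) ` (Basis \<rightarrow>\<^sub>E UNIV)" for v
  proof -
    have "v \<in> span Basis"
      by (simp add: span_Basis)
    then obtain c where "v = (\<Sum>b\<in>Basis. scale (c b) b)"
      by (auto simp: span_finite[OF finite_Basis])
    then show ?thesis
      by (intro image_eqI[of _ _ "restrict c Basis"]) auto
  qed
  then have "UNIV \<subseteq> (\<lambda>c. \<Sum>b\<in>Basis. scale (c b) b) ` (Basis \<rightarrow>\<^sub>E UNIV)"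
    by blast
  moreover have "finite (Basis \<rightarrow>\<^sub>E (UNIV :: 'f set))"
    by (intro finite_PiE finite_Basis) auto
  ultimately show ?thesis
    by (rule finite_surj[rotated])
qed

text \<open>Counting replaces the dual space: a functional is determined by its values on the basis,
  and there are as many vectors as there are families of values.\<close>

lemma functional_represented:
  fixes scale :: "'f::{field,finite} \<Rightarrow> 'v::ab_group_add \<Rightarrow> 'v" and \<beta> :: "'v \<Rightarrow> 'v \<Rightarrow> 'f"
  assumes "finite_dimensional_vector_space scale Basis"
    and \<beta>: "biadditive \<beta>" "\<And>c u v. \<beta> (scale c u) v = c * \<beta> u v"
    and nondeg: "\<And>v. (\<And>u. \<beta> u v = 0) \<Longrightarrow> v = 0"
    and \<gamma>: "additive \<gamma>" "\<And>c u. \<gamma> (scale c u) = c * \<gamma> u"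
  shows "\<exists>v. \<forall>u. \<beta> u v = \<gamma> u"
proof -
  interpret finite_dimensional_vector_space scale Basis
    by fact
  let ?F = "Basis \<rightarrow>\<^sub>E (UNIV :: 'f set)"
  let ?h = "\<lambda>v. restrict (\<lambda>b. \<beta> b v) Basis" and ?r = "\<lambda>c. \<Sum>b\<in>Basis. scale (c b) b"
  have det: "\<delta> u = \<epsilon> u"
    if "additive \<delta>" "\<And>c u. \<delta> (scale c u) = c * \<delta> u" "additive \<epsilon>" "\<And>c u. \<epsilon> (scale c u) = c * \<epsilon> u"
      "\<And>b. b \<in> Basis \<Longrightarrow> \<delta> b = \<epsilon> b" for \<delta> \<epsilon> :: "'v \<Rightarrow> 'f" and u
  proof -
    have "u \<in> span Basis"
      by (simp add: span_Basis)
    then show ?thesis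
    proof (induction rule: span_induct_alt)
      case (step c x y)
      then show ?case
        using that(5)[of x] by (simp add: additive_simps[OF that(1)] additive_simps[OF that(3)] that(2,4))
    qed (simp add: additive_simps[OF that(1)] additive_simps[OF that(3)])
  qed
  have additive\<beta>: "additive (\<lambda>u. \<beta> u v)" for v
    using \<beta>(1) by (simp add: biadditive_def)
  have "inj ?h"
  proof (rule injI)
    fix v w assume eq: "?h v = ?h w"
    have "\<beta> b v = \<beta> b w" if "b \<in> Basis" for b
      using fun_cong[OF eq, of b] that by simp
    then have "\<beta> u v = \<beta> u w" for u
      using det[OF additive\<beta> \<beta>(2) additive\<beta> \<beta>(2)] by blast
    then have "v - w = 0"
      by (intro nondeg) (simp add: biadditive_simps[OF \<beta>(1)])
    then show "v = w"
      by simp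
  qed
  have finF: "finite ?F"
    by (intro finite_PiE finite_Basis) auto
  \<comment> \<open>Independence of the basis shows that there are at least as many vectors as value
    families, so the injection \<open>?h\<close> must be onto.\<close>
  have "inj_on ?r ?F"
  proof (rule inj_onI)
    fix c d assume cd: "c \<in> ?F" "d \<in> ?F" "?r c = ?r d"
    then have "(\<Sum>b\<in>Basis. scale (c b - d b) b) = 0"
      by (simp add: scale_left_diff_distrib sum_subtractf)
    then have "c b - d b = 0" if "b \<in> Basis" for b
      using independentD[OF independent_Basis finite_Basis subset_refl, of "\<lambda>b. c b - d b"] that by simp
    then show "c = d"
      using cd(1,2) by (intro PiE_ext) auto
  qed
  from card_inj_on_le[OF this subset_UNIV finite_UNIV_vector_space[OF assms(1)]]
  have "card ?F \<le> card (range ?h)"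
    by (simp add: card_image[OF \<open>inj ?h\<close>])
  then have "range ?h = ?F"
    by (intro card_seteq finF) auto
  moreover have "restrict \<gamma> Basis \<in> ?F"
    by auto
  ultimately have "restrict \<gamma> Basis \<in> range ?h"
    by simp
  then obtain v where v: "?h v = restrict \<gamma> Basis"
    by (metis (lifting) rangeE)
  have "\<beta> b v = \<gamma> b" if "b \<in> Basis" for b
    using fun_cong[OF v, of b] that by simp
  then have "\<forall>u. \<beta> u v = \<gamma> u"
    using det[OF additive\<beta> \<beta>(2) \<gamma>] by blast
  then show ?thesis ..
qed

section \<open>Congruence of alternating forms\<close>

text \<open>The twist \<open>\<psi>\<close> is \<open>id\<close> for alternating and symmetric forms
  and the \<open>q\<close>-th power for hermitian ones.\<close>

definition sesquilinear ::
  "('f::field \<Rightarrow> 'v::ab_group_add \<Rightarrow> 'v) \<Rightarrow> ('f \<Rightarrow> 'f) \<Rightarrow> ('v \<Rightarrow> 'v \<Rightarrow> 'f) \<Rightarrow> bool" where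
  "sesquilinear scale \<psi> \<beta> \<longleftrightarrow> biadditive \<beta> \<and>
    (\<forall>c u v. \<beta> (scale c u) v = c * \<beta> u v \<and> \<beta> u (scale c v) = \<psi> c * \<beta> u v)"

lemma sesquilinear_simps:
  assumes "sesquilinear scale \<psi> \<beta>"
  shows "biadditive \<beta>" "\<beta> (scale c u) v = c * \<beta> u v" "\<beta> u (scale c v) = \<psi> c * \<beta> u v"
    "\<beta> (u + x) w = \<beta> u w + \<beta> x w" "\<beta> u (w + x) = \<beta> u w + \<beta> u x"
    "\<beta> (u - x) w = \<beta> u w - \<beta> x w" "\<beta> u (w - x) = \<beta> u w - \<beta> u x"
    "\<beta> (- u) w = - \<beta> u w" "\<beta> u (- w) = - \<beta> u w" "\<beta> 0 w = 0" "\<beta> u 0 = 0"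
  using assms by (auto simp: sesquilinear_def biadditive_simps)

definition nondegenerate_on :: "('v::zero \<Rightarrow> 'v \<Rightarrow> 'f::zero) \<Rightarrow> 'v set \<Rightarrow> bool" where
  "nondegenerate_on \<beta> W \<longleftrightarrow> (\<forall>u\<in>W. (\<forall>v\<in>W. \<beta> u v = 0) \<longrightarrow> u = 0)"

lemma alternating_skew:
  assumes "biadditive \<beta>" "\<And>v. \<beta> v v = 0"
  shows "\<beta> v u = - \<beta> u v"
proof -
  have "\<beta> (u + v) (u + v) = \<beta> u u + \<beta> v v + (\<beta> v u + \<beta> u v)"
    by (simp add: biadditive_simps[OF assms(1)] add_ac)
  then show ?thesis
    by (simp add: assms(2) eq_neg_iff_add_eq_0)
qed

section \<open>Splitting off a hyperbolic plane\<close>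

context
  fixes scale :: "'f::{field,finite} \<Rightarrow> 'v::ab_group_add \<Rightarrow> 'v" and \<beta> W u v
  assumes vs: "vector_space scale" and \<beta>: "sesquilinear scale id \<beta>"
    and alt: "\<And>v. \<beta> v v = 0"
    and W: "module.subspace scale W" and uv: "u \<in> W" "v \<in> W" "\<beta> u v = 1"
begin

interpretation vector_space scale
  by (rule vs)

lemma hyperbolic_values: "\<beta> v u = -1" "\<beta> u u = 0" "\<beta> v v = 0"
  using alternating_skew[of \<beta> v u] sesquilinear_simps(1)[OF \<beta>] alt uv by auto

lemma hyperbolic_complement_subspace: "subspace {w \<in> W. \<beta> w u = 0 \<and> \<beta> w v = 0}"
  using W by (auto simp: subspace_def sesquilinear_simps[OF \<beta>])

text \<open>The component of \<open>x\<close> in the plane is \<open>a u + b v\<close> with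
  \<open>a = \<beta> x v\<close> and \<open>b = - \<beta> x u\<close>, the sign coming from
  \<open>\<beta> v u = -1\<close>.\<close>

lemma hyperbolic_projection:
  assumes "x \<in> W"
  shows "x - (scale (\<beta> x v) u - scale (\<beta> x u) v) \<in> {w \<in> W. \<beta> w u = 0 \<and> \<beta> w v = 0}"
  using assms uv W hyperbolic_values
  by (auto simp: sesquilinear_simps[OF \<beta>] intro!: subspace_diff subspace_scale)

lemma hyperbolic_complement_nondegenerate:
  assumes nd: "nondegenerate_on \<beta> W"
  shows "nondegenerate_on \<beta> {w \<in> W. \<beta> w u = 0 \<and> \<beta> w v = 0}"
  unfolding nondegenerate_on_def
proof safe
  fix w assume w: "w \<in> W" "\<beta> w u = 0" "\<beta> w v = 0"
    and orth: "\<forall>x\<in>{w \<in> W. \<beta> w u = 0 \<and> \<beta> w v = 0}. \<beta> w x = 0"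
  have "\<beta> w x = 0" if "x \<in> W" for x
    using orth[rule_format, OF hyperbolic_projection[OF that]] w(2,3)
    by (simp add: sesquilinear_simps[OF \<beta>])
  then show "w = 0"
    using nd w(1) by (auto simp: nondegenerate_on_def)
qed

text \<open>The form reads off the coordinates in the plane, so \<open>W\<close> is in bijection
  with pairs of scalars together with a vector of the complement. Cardinality replaces dimension:
  complements in spaces of equal size have equal size.\<close>

lemma card_hyperbolic_complement:
  "card W = CARD('f) * CARD('f) * card {w \<in> W. \<beta> w u = 0 \<and> \<beta> w v = 0}"
proof -
  let ?U = "{w \<in> W. \<beta> w u = 0 \<and> \<beta> w v = 0}"
  let ?f = "\<lambda>((a, b), w). scale a u + scale b v + w"
  have val: "\<beta> (?f ((a, b), w)) v = a" "\<beta> (?f ((a, b), w)) u = - b" if "w \<in> ?U" for a b w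
    using that uv hyperbolic_values by (simp_all add: sesquilinear_simps[OF \<beta>])
  have "bij_betw ?f ((UNIV \<times> UNIV) \<times> ?U) W"
    unfolding bij_betw_def
  proof (intro conjI equalityI subsetI)
    show "inj_on ?f ((UNIV \<times> UNIV) \<times> ?U)"
    proof (rule inj_onI)
      fix p r assume pr: "p \<in> (UNIV \<times> UNIV) \<times> ?U" "r \<in> (UNIV \<times> UNIV) \<times> ?U" "?f p = ?f r"
      obtain a b w a' b' w' where eq: "p = ((a, b), w)" "r = ((a', b'), w')"
        by (metis surj_pair)
      have ww: "w \<in> ?U" "w' \<in> ?U"
        using pr eq by auto
      have "a = a'" "b = b'"
        using val[OF ww(1), of a b] val[OF ww(2), of a' b'] pr(3) unfolding eq by simp_all
      then show "p = r"
        using pr(3) eq by simp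
    qed
  next
    fix x assume "x \<in> ?f ` ((UNIV \<times> UNIV) \<times> ?U)"
    then show "x \<in> W"
      using W uv by (auto intro!: subspace_add subspace_scale)
  next
    fix x assume x: "x \<in> W"
    show "x \<in> ?f ` ((UNIV \<times> UNIV) \<times> ?U)"
      using hyperbolic_projection[OF x]
      by (intro image_eqI[of _ _ "((\<beta> x v, - \<beta> x u), x - (scale (\<beta> x v) u - scale (\<beta> x u) v))"]) auto
  qed
  then have "card W = card ((UNIV \<times> UNIV :: ('f \<times> 'f) set) \<times> ?U)"
    by (simp add: bij_betw_same_card)
  then show ?thesis
    by (simp add: card_cartesian_product)
qed

end

text \<open>If \<open>T x = T y\<close>, then \<open>x - y\<close> is orthogonal to all of
  \<open>W2\<close> and hence zero; equal finite cardinalities give surjectivity.\<close>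

lemma isometry_on_bij:
  assumes "vector_space scale" "sesquilinear scale \<psi> \<beta>2"
    and W2: "module.subspace scale W2" and nd: "nondegenerate_on \<beta>2 W2" and fin: "finite W1" "card W1 = card W2"
    and T: "T ` W2 \<subseteq> W1" "\<And>x y. x \<in> W2 \<Longrightarrow> y \<in> W2 \<Longrightarrow> \<beta>1 (T x) (T y) = \<beta>2 x y"
  shows "bij_betw T W2 W1"
proof -
  interpret vector_space scale by fact
  have "inj_on T W2"
  proof (rule inj_onI)
    fix x y assume xy: "x \<in> W2" "y \<in> W2" "T x = T y"
    have "\<beta>2 (x - y) z = 0" if "z \<in> W2" for z
      using T(2)[OF xy(1) that] T(2)[OF xy(2) that] xy(3) by (simp add: sesquilinear_simps[OF assms(2)])
    moreover have "x - y \<in> W2"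
      using xy W2 by (intro subspace_diff) auto
    ultimately have "x - y = 0"
      using nd by (auto simp: nondegenerate_on_def)
    then show "x = y"
      by simp
  qed
  then show ?thesis
    using T(1) fin card_image[of T W2] card_subset_eq[of W1 "T ` W2"] by (auto simp: bij_betw_def)
qed

text \<open>Both spaces lose a hyperbolic plane at each step, until only the zero space is left; so
  the cardinality is the only invariant.\<close>

lemma alternating_congruent_on:
  fixes scale :: "'f::{field,finite} \<Rightarrow> 'v::ab_group_add \<Rightarrow> 'v"
  assumes vs: "vector_space scale" and fin: "finite (UNIV :: 'v set)"
    and \<beta>1: "sesquilinear scale id \<beta>1" "\<And>v. \<beta>1 v v = 0"
    and \<beta>2: "sesquilinear scale id \<beta>2" "\<And>v. \<beta>2 v v = 0"
    and "module.subspace scale W1" "module.subspace scale W2"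
    and "nondegenerate_on \<beta>1 W1" "nondegenerate_on \<beta>2 W2" and "card W1 = card W2"
  shows "congruent_on scale \<beta>1 W1 scale \<beta>2 W2"
  using assms(7-)
proof (induction "card W1" arbitrary: W1 W2 rule: less_induct)
  case (less W1 W2)
  interpret vector_space scale
    by (rule vs)
  note W1 = less.prems(1) and W2 = less.prems(2)
  have finW: "finite W1" "finite W2"
    using finite_subset[OF subset_UNIV fin] by auto
  have hyp: "\<exists>u\<in>W. \<exists>v\<in>W. \<beta> u v = 1"
    if hy: "sesquilinear scale id \<beta>" "subspace W" "nondegenerate_on \<beta> W" "card W \<noteq> 1" for \<beta> W
  proof -
    have "W \<noteq> {0}"
      using hy(4) by auto
    then obtain u where u: "u \<in> W" "u \<noteq> 0"
      using subspace_0[OF hy(2)] by blast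
    then obtain v where v: "v \<in> W" "\<beta> u v \<noteq> 0"
      using hy(3) by (auto simp: nondegenerate_on_def)
    have "\<beta> u (scale (inverse (\<beta> u v)) v) = 1"
      using v by (simp add: sesquilinear_simps[OF hy(1)])
    then show ?thesis
      using u v subspace_scale[OF hy(2)] by blast
  qed
  show ?case
  proof (cases "card W1 = 1")
    case True
    then have "W1 = {0}" "W2 = {0}"
      using subspace_0[OF W1] subspace_0[OF W2] less.prems(5) by (auto simp: card_1_singleton_iff)
    then show ?thesis
      unfolding congruent_on_def
      by (intro exI[of _ id]) (simp add: sesquilinear_simps[OF \<beta>1(1)] sesquilinear_simps[OF \<beta>2(1)])
  next
    case False
    obtain u1 v1 where uv1: "u1 \<in> W1" "v1 \<in> W1" "\<beta>1 u1 v1 = 1"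
      using hyp[OF \<beta>1(1) W1 less.prems(3)] False by blast
    obtain u2 v2 where uv2: "u2 \<in> W2" "v2 \<in> W2" "\<beta>2 u2 v2 = 1"
      using hyp[OF \<beta>2(1) W2 less.prems(4)] False less.prems(5) by auto
    let ?U1 = "{w \<in> W1. \<beta>1 w u1 = 0 \<and> \<beta>1 w v1 = 0}"
    let ?U2 = "{w \<in> W2. \<beta>2 w u2 = 0 \<and> \<beta>2 w v2 = 0}"
    note H1 = vs \<beta>1 W1 uv1 and H2 = vs \<beta>2 W2 uv2
    have "u1 \<notin> ?U1"
      using uv1(3) by simp
    then have "?U1 \<subset> W1"
      using uv1(1) by blast
    then have "card ?U1 < card W1"
      using finW(1) by (simp add: psubset_card_mono)
    moreover have "card ?U1 = card ?U2"
      using card_hyperbolic_complement[OF H1] card_hyperbolic_complement[OF H2] less.prems(5) by simp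
    ultimately have "congruent_on scale \<beta>1 ?U1 scale \<beta>2 ?U2"
      using less.hyps hyperbolic_complement_subspace[OF H1] hyperbolic_complement_subspace[OF H2]
        hyperbolic_complement_nondegenerate[OF H1 less.prems(3)]
        hyperbolic_complement_nondegenerate[OF H2 less.prems(4)] by blast
    then obtain S where S: "bij_betw S ?U2 ?U1"
      "\<And>x y. x \<in> ?U2 \<Longrightarrow> y \<in> ?U2 \<Longrightarrow> S (x + y) = S x + S y"
      "\<And>c x. x \<in> ?U2 \<Longrightarrow> S (scale c x) = scale c (S x)"
      "\<And>x y. x \<in> ?U2 \<Longrightarrow> y \<in> ?U2 \<Longrightarrow> \<beta>1 (S x) (S y) = \<beta>2 x y"
      unfolding congruent_on_def by blast
    \<comment> \<open>\<open>P\<close> projects onto the complement of the plane in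
      \<open>W2\<close>. The map \<open>T\<close> then sends \<open>u2\<close> to \<open>u1\<close>,
      \<open>v2\<close> to \<open>v1\<close>, and acts on the complement by the inductive isometry
      \<open>S\<close>.\<close>
    define P where "P x = x - (scale (\<beta>2 x v2) u2 - scale (\<beta>2 x u2) v2)" for x
    define T where "T x = scale (\<beta>2 x v2) u1 - scale (\<beta>2 x u2) v1 + S (P x)" for x
    have P: "P x \<in> ?U2" if "x \<in> W2" for x
      unfolding P_def using hyperbolic_projection[OF H2 that] .
    have SP: "S (P x) \<in> ?U1" if "x \<in> W2" for x
      using P[OF that] S(1) by (auto simp: bij_betw_def)
    note s1 = sesquilinear_simps[OF \<beta>1(1)] and s2 = sesquilinear_simps[OF \<beta>2(1)]
    note h1 = hyperbolic_values[OF H1] and h2 = hyperbolic_values[OF H2]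
    have skew1: "\<beta>1 x y = - \<beta>1 y x" for x y
      by (rule alternating_skew[OF s1(1) \<beta>1(2)])
    have skew2: "\<beta>2 x y = - \<beta>2 y x" for x y
      by (rule alternating_skew[OF s2(1) \<beta>2(2)])
    have TW: "T ` W2 \<subseteq> W1"
      using uv1 SP W1 by (auto simp: T_def intro!: subspace_add subspace_diff subspace_scale)
    have iso: "\<beta>1 (T x) (T y) = \<beta>2 x y" if xy: "x \<in> W2" "y \<in> W2" for x y
    proof -
      have z1: "\<beta>1 (S (P z)) u1 = 0" "\<beta>1 (S (P z)) v1 = 0" "\<beta>1 u1 (S (P z)) = 0" "\<beta>1 v1 (S (P z)) = 0"
        if "z \<in> W2" for z
        using SP[OF that] skew1[of u1] skew1[of v1] by auto
      have z2: "\<beta>2 (P z) u2 = 0" "\<beta>2 (P z) v2 = 0" "\<beta>2 u2 (P z) = 0" "\<beta>2 v2 (P z) = 0"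
        if "z \<in> W2" for z
        using P[OF that] skew2[of u2] skew2[of v2] by auto
      have "\<beta>2 x y = \<beta>2 (scale (\<beta>2 x v2) u2 - scale (\<beta>2 x u2) v2 + P x)
          (scale (\<beta>2 y v2) u2 - scale (\<beta>2 y u2) v2 + P y)"
        by (simp add: P_def)
      also have "\<dots> = \<beta>2 x u2 * \<beta>2 y v2 - \<beta>2 x v2 * \<beta>2 y u2 + \<beta>2 (P x) (P y)"
        using xy by (simp add: s2 h2 uv2 z2 algebra_simps del: P_def)
      also have "\<dots> = \<beta>1 (T x) (T y)"
        using xy S(4)[OF P P] by (simp add: T_def s1 h1 uv1 z1 algebra_simps)
      finally show ?thesis ..
    qed
    have "bij_betw T W2 W1"
      by (rule isometry_on_bij[OF vs \<beta>2(1) W2 less.prems(4) finW(1) less.prems(5) TW iso])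
    moreover have "T (x + y) = T x + T y" if "x \<in> W2" "y \<in> W2" for x y
    proof -
      have "P (x + y) = P x + P y"
        by (simp add: P_def s2 algebra_simps)
      then show ?thesis
        using S(2)[OF P P] that by (simp add: T_def s2 algebra_simps)
    qed
    moreover have "T (scale c x) = scale c (T x)" if "x \<in> W2" for c x
    proof -
      have "P (scale c x) = scale c (P x)"
        by (simp add: P_def s2 algebra_simps)
      then show ?thesis
        using S(3)[OF P] that by (simp add: T_def s2 algebra_simps)
    qed
    ultimately show ?thesis
      unfolding congruent_on_def using iso by blast
  qed
qed

section \<open>Operators of finite order prime to the characteristic\<close>

locale finite_order_operator = vector_space scale
  for scale :: "'f::field \<Rightarrow> 'v::ab_group_add \<Rightarrow> 'v" +
  fixes X X' :: "'v \<Rightarrow> 'v" and n :: nat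
  assumes fin: "finite (UNIV :: 'v set)"
    and X_additive: "additive X" and X_scale: "X (scale c v) = scale c (X v)"
    and X_X' [simp]: "X (X' v) = v" and X'_X [simp]: "X' (X v) = v"
    and X_order: "(X ^^ n) v = v" and n: "of_nat n \<noteq> (0 :: 'f)"
begin

section \<open>The difference of an operator and its inverse\<close>

lemmas X_simps = additive_simps[OF X_additive] X_scale

lemma X'_additive: "additive X'"
proof
  fix x y
  have "X (X' (x + y)) = X (X' x + X' y)"
    by (simp add: X_simps)
  then show "X' (x + y) = X' x + X' y"
    by (metis X'_X)
qed

lemma X'_scale: "X' (scale c v) = scale c (X' v)"
proof -
  have "X (X' (scale c v)) = X (scale c (X' v))"
    by (simp add: X_simps)
  then show ?thesis
    by (metis X'_X)
qed

lemmas X'_simps = additive_simps[OF X'_additive] X'_scale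

text \<open>The adjoint of an isometry is its inverse, so this is \<open>X\<close> minus its adjoint
  for every form that \<open>X\<close> preserves. Its kernel is the subspace on which
  \<open>X\<close> squares to the identity.\<close>

definition D :: "'v \<Rightarrow> 'v" where
  "D v = X v - X' v"

lemma D_additive: "additive D"
  by (simp add: additive_def D_def X_simps X'_simps)

lemma D_scale: "D (scale c v) = scale c (D v)"
  by (simp add: D_def X_simps X'_simps scale_right_diff_distrib)

text \<open>Here the order of \<open>X\<close> being prime to the characteristic enters: \<open>(Y - 1)\<^sup>2 w = 0\<close> gives
  \<open>Y\<^sup>n w = w + n (Y - 1) w\<close>.\<close>

lemma fixed_if_unipotent:
  assumes Y: "additive Y" "\<And>c v. Y (scale c v) = scale c (Y v)" "(Y ^^ n) w = w"
    and w: "Y (Y w - w) = Y w - w"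
  shows "Y w = w"
proof -
  have "(Y ^^ k) w = w + scale (of_nat k) (Y w - w)" for k
  proof (induction k)
    case (Suc k)
    have "Y (w + scale (of_nat k) (Y w - w)) = Y w + scale (of_nat k) (Y w - w)"
      using w by (simp add: additive_simps(1)[OF Y(1)] Y(2))
    then show ?case
      using Suc by (simp add: scale_left_distrib)
  qed simp
  then have "scale (of_nat n) (Y w - w) = 0"
    using Y(3) by (metis add_cancel_right_right)
  then show ?thesis
    using n by simp
qed

lemma X_square_pow: "((\<lambda>v. X (X v)) ^^ k) v = (X ^^ k) ((X ^^ k) v)"
  by (induction k arbitrary: v) (simp_all add: funpow_swap1)

text \<open>Because \<open>X^2 - 1 = X D\<close> and \<open>X\<close> commutes with
  \<open>D\<close>, the assumption says that \<open>(X^2 - 1)^2\<close> kills \<open>w\<close>; the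
  unipotence argument for \<open>X^2\<close> gives \<open>X^2 w = w\<close>, that is
  \<open>D w = 0\<close>.\<close>

lemma D_D_eq_0:
  assumes "D (D w) = 0"
  shows "D w = 0"
proof -
  have w: "X (X u) - u = X (D u)" for u
    by (simp add: D_def X_simps)
  have DX: "D (X u) = X (D u)" for u
    by (simp add: D_def X_simps)
  have "X (X w) = w"
  proof (rule fixed_if_unipotent[of "\<lambda>v. X (X v)"])
    show "additive (\<lambda>v. X (X v))"
      by (simp add: additive_def X_simps)
    have "X (X (X (D w))) - X (D w) = X (X (D (D w)))"
      by (simp only: w DX)
    also have "\<dots> = 0"
      using assms by (simp add: additive_simps(2)[OF X_additive])
    finally have "X (X (X (D w))) = X (D w)"
      by (simp only: right_minus_eq)
    then show "X (X (X (X w) - w)) = X (X w) - w"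
      by (simp only: w)
  qed (simp_all add: X_simps X_square_pow X_order)
  then show ?thesis
    by (metis D_def X'_X right_minus_eq)
qed

lemma D_pow_additive: "additive (D ^^ k)"
  by (induction k) (use D_additive in \<open>simp_all add: additive_def\<close>)

lemma D_pow_scale: "(D ^^ k) (scale c v) = scale c ((D ^^ k) v)"
  by (induction k) (simp_all add: D_scale)

lemma D_pow_commute:
  assumes "\<And>v. Z (D v) = D (Z v)"
  shows "Z ((D ^^ k) v) = (D ^^ k) (Z v)"
  by (induction k) (simp_all add: assms)

lemma D_pow_eq_0: "(D ^^ Suc k) w = 0 \<Longrightarrow> D w = 0"
proof (induction k)
  case (Suc k)
  then have "D (D ((D ^^ k) w)) = 0"
    by simp
  then have "(D ^^ Suc k) w = 0"
    using D_D_eq_0 by simp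
  then show ?case
    by (rule Suc.IH)
qed simp

text \<open>Fitting's decomposition for \<open>D\<close>: a power is idempotent by finiteness, and
  no power enlarges the kernel. The exponent is even because \<open>D\<close> is skew, so that only
  its even powers are sure to be self-adjoint, as the orthogonal splitting requires.\<close>

lemma fitting_idempotent:
  "\<exists>N. (\<forall>v. (D ^^ (2 * N)) ((D ^^ (2 * N)) v) = (D ^^ (2 * N)) v) \<and>
    (\<forall>v. (D ^^ (2 * N)) v = 0 \<longleftrightarrow> D v = 0)"
proof -
  have "finite (range (\<lambda>i. D ^^ (2 * i)))"
    using finite_UNIV_fun[OF fin fin] finite_subset subset_UNIV by blast
  moreover have "D ^^ (2 * (i + k)) = D ^^ (2 * (j + k))" if "D ^^ (2 * i) = D ^^ (2 * j)" for i j k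
    using that by (simp add: distrib_left funpow_add)
  ultimately obtain N where N: "N \<ge> 1" "D ^^ (2 * (N + N)) = D ^^ (2 * N)"
    using finite_range_idempotent_index[of "\<lambda>i. D ^^ (2 * i)"] by blast
  have "(D ^^ (2 * N)) ((D ^^ (2 * N)) v) = (D ^^ (2 * N)) v" for v
    using fun_cong[OF N(2), of v] by (simp only: distrib_left funpow_add o_apply)
  moreover obtain m where m: "2 * N = Suc m"
    using N(1) by (cases "2 * N") auto
  have "(D ^^ (2 * N)) v = 0 \<longleftrightarrow> D v = 0" for v
    using D_pow_eq_0[of m v] additive_simps(2)[OF D_pow_additive]
    unfolding m by (auto simp: funpow_Suc_right simp del: funpow.simps)
  ultimately show ?thesis
    by blast
qed

text \<open>On the kernel of \<open>D\<close> one has \<open>X^2 = 1\<close>, which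
  \<open>(1 + X)/2\<close> and \<open>(1 - X)/2\<close> split when 2 is invertible. In
  characteristic two the eigenvalues 1 and -1 coincide; the last clause makes \<open>Q\<close> zero
  there, so that this eigenspace is not counted twice.\<close>

lemma spectral_decomposition:
  obtains N P Q where
    "\<And>v. (D ^^ (2 * N)) ((D ^^ (2 * N)) v) = (D ^^ (2 * N)) v"
    "\<And>v. D v = 0 \<Longrightarrow> (D ^^ (2 * N)) v = 0"
    "additive P" "\<And>c v. P (scale c v) = scale c (P v)" "\<And>v. P (X v) = X (P v)" "\<And>v. X (P v) = P v"
    "additive Q" "\<And>c v. Q (scale c v) = scale c (Q v)" "\<And>v. Q (X v) = X (Q v)" "\<And>v. X (Q v) = - Q v"
    "\<And>v. v = (D ^^ (2 * N)) v + P v + Q v"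
    "(1 :: 'f) + 1 \<noteq> 0 \<or> (\<forall>v. Q v = 0)"
proof -
  obtain N where N: "\<And>v. (D ^^ (2 * N)) ((D ^^ (2 * N)) v) = (D ^^ (2 * N)) v"
    "\<And>v. (D ^^ (2 * N)) v = 0 \<longleftrightarrow> D v = 0"
    using fitting_idempotent by blast
  define R where "R v = v - (D ^^ (2 * N)) v" for v
  note Dp = additive_simps[OF D_pow_additive] D_pow_scale
  have R_additive: "additive R"
    by (simp add: additive_def R_def Dp)
  have R_scale: "R (scale c v) = scale c (R v)" for c v
    by (simp add: R_def Dp scale_right_diff_distrib)
  have R_X: "R (X v) = X (R v)" for v
    using D_pow_commute[of X "2 * N" v] by (simp add: R_def X_simps D_def)
  note R = additive_simps[OF R_additive] R_scale R_X
  have XX: "X (X (R v)) = R v" for v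
  proof -
    have "D (R v) = 0"
      using N by (simp add: R_def Dp flip: N(2))
    then show ?thesis
      by (simp add: D_def)
  qed
  show thesis
  proof (cases "(1 :: 'f) + 1 = 0")
    case True
    have dbl: "v + v = 0" for v :: 'v
    proof -
      have "v + v = scale (1 + 1) v"
        by (simp only: scale_left_distrib scale_one)
      then show ?thesis
        by (simp only: True scale_zero_left)
    qed
    \<comment> \<open>The vector \<open>X (R v) - R v\<close> is negated by \<open>X\<close> because
      \<open>X^2 = 1\<close> on the range of \<open>R\<close>; in characteristic two it is therefore
      fixed, and the unipotence argument applies.\<close>
    have XR: "X (R v) = R v" for v
    proof (rule fixed_if_unipotent[OF X_additive X_scale X_order])
      have "X (X (R v) - R v) + (X (R v) - R v) = 0"
        by (simp add: X_simps XX)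
      moreover have "(X (R v) - R v) + (X (R v) - R v) = 0"
        by (rule dbl)
      ultimately show "X (X (R v) - R v) = X (R v) - R v"
        by (metis add_right_cancel)
    qed
    show thesis
    proof (rule that[of N R "\<lambda>_. 0"])
      show "additive R" "additive (\<lambda>_. 0 :: 'v)"
        by (rule R_additive) (simp add: additive_def)
      show "v = (D ^^ (2 * N)) v + R v + 0" for v
        by (simp add: R_def)
    qed (use N in \<open>simp_all add: R_scale R_X XR X_simps\<close>)
  next
    case False
    let ?h = "inverse (1 + 1 :: 'f)"
    let ?P = "\<lambda>v. scale ?h (R v + X (R v))" and ?Q = "\<lambda>v. scale ?h (R v - X (R v))"
    have h: "?h + ?h = 1"
      using False by (metis mult_2 one_add_one right_inverse)
    have sum: "?P v + ?Q v = R v" for v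
    proof -
      have "?P v + ?Q v = scale (?h + ?h) (R v)"
        by (simp only: scale_left_distrib scale_right_distrib scale_right_diff_distrib) simp
      then show ?thesis
        by (simp only: h scale_one)
    qed
    show thesis
    proof (rule that[of N ?P ?Q])
      show "additive ?P" "additive ?Q"
        by (simp_all add: additive_def R X_simps scale_right_distrib scale_right_diff_distrib)
      show "?P (scale c v) = scale c (?P v)" "?Q (scale c v) = scale c (?Q v)" for c v
        by (simp_all add: R X_simps scale_right_distrib scale_right_diff_distrib mult.commute)
      show "?P (X v) = X (?P v)" "?Q (X v) = X (?Q v)" for v
        by (simp_all add: R_X X_simps)
      show "X (?P v) = ?P v" "X (?Q v) = - ?Q v" for v
        by (simp_all add: X_simps XX add.commute flip: scale_minus_right)
      show "v = (D ^^ (2 * N)) v + ?P v + ?Q v" for v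
        using sum[of v] by (simp add: R_def add.assoc)
    qed (use N False in auto)
  qed
qed

end

text \<open>\<open>A v\<close> is the vector representing the functional \<open>\<gamma> _ v\<close>
  through \<open>\<beta>\<close>; the twist \<open>\<psi>\<close> occurs on both sides and cancels,
  so \<open>A\<close> is linear. The last clause says that \<open>A\<close> commutes with each
  operator whose adjoints for the two forms agree, which is how it comes to commute with
  \<open>X\<close>.\<close>

lemma form_quotient:
  fixes scale :: "'f::{field,finite} \<Rightarrow> 'v::ab_group_add \<Rightarrow> 'v"
  assumes "finite_dimensional_vector_space scale Basis"
    and \<beta>: "sesquilinear scale \<psi> \<beta>" "\<And>u v. \<beta> v u = \<phi> (\<beta> u v)" "nondegenerate \<beta>"
    and \<gamma>: "sesquilinear scale \<psi> \<gamma>" "\<And>u v. \<gamma> v u = \<phi> (\<gamma> u v)" "nondegenerate \<gamma>"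
  obtains A where "additive A" "\<And>c v. A (scale c v) = scale c (A v)" "\<And>v. A v = 0 \<Longrightarrow> v = 0"
    "\<And>u v. \<beta> (A u) v = \<gamma> u v" "\<And>u v. \<beta> u (A v) = \<gamma> u v"
    "\<forall>Z Z'. (\<forall>u v. \<beta> (Z' u) v = \<beta> u (Z v)) \<longrightarrow> (\<forall>u v. \<gamma> (Z' u) v = \<gamma> u (Z v)) \<longrightarrow> (\<forall>v. A (Z v) = Z (A v))"
proof -
  note s\<beta> = sesquilinear_simps[OF \<beta>(1)] and s\<gamma> = sesquilinear_simps[OF \<gamma>(1)]
  have nd: "v = 0" if "\<And>u. \<beta> u v = 0" for v
  proof -
    have "\<beta> v u = \<phi> (\<beta> u v)" "\<beta> 0 u = \<phi> (\<beta> u 0)" for u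
      by (rule \<beta>(2))+
    then have "\<beta> v u = 0" for u
      using that by (simp add: s\<beta>)
    then show ?thesis
      using \<beta>(3) by (simp add: nondegenerate_def)
  qed
  have eqI: "x = y" if "\<And>u. \<beta> u x = \<beta> u y" for x y
    using nd[of "x - y"] that by (simp add: s\<beta>)
  have "\<exists>w. \<forall>u. \<beta> u w = \<gamma> u v" for v
    by (rule functional_represented[OF assms(1) s\<beta>(1,2) nd]) (simp_all add: additive_def s\<gamma>)
  then obtain A where A: "\<beta> u (A v) = \<gamma> u v" for u v
    by metis
  show thesis
  proof (rule that)
    show "additive A"
      unfolding additive_def by (intro allI eqI) (simp add: A s\<beta> s\<gamma>)
    show "A (scale c v) = scale c (A v)" for c v
      by (intro eqI) (simp add: A s\<beta> s\<gamma>)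
    show "\<beta> (A u) v = \<gamma> u v" for u v
      by (metis A \<beta>(2) \<gamma>(2))
    then show "v = 0" if "A v = 0" for v
      using \<gamma>(3) that by (metis nondegenerate_def s\<beta>(10))
    have "A (Z v) = Z (A v)"
      if "\<And>u v. \<beta> (Z' u) v = \<beta> u (Z v)" "\<And>u v. \<gamma> (Z' u) v = \<gamma> u (Z v)" for Z Z' v
      by (intro eqI) (simp add: A that flip: that)
    then show "\<forall>Z Z'. (\<forall>u v. \<beta> (Z' u) v = \<beta> u (Z v)) \<longrightarrow> (\<forall>u v. \<gamma> (Z' u) v = \<gamma> u (Z v)) \<longrightarrow>
        (\<forall>v. A (Z v) = Z (A v))"
      by blast
  qed (rule A)
qed

lemma isometry_adjoint:
  assumes "\<And>u v. \<beta> (X u) (X v) = \<beta> u v" "\<And>v. X (X' v) = v"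
  shows "\<beta> (X u) v = \<beta> u (X' v)" "\<beta> (X' u) v = \<beta> u (X v)"
proof -
  show "\<beta> (X u) v = \<beta> u (X' v)"
    using assms(1)[of u "X' v"] by (simp add: assms(2))
  show "\<beta> (X' u) v = \<beta> u (X v)"
    using assms(1)[of "X' u" v] by (simp add: assms(2))
qed

text \<open>Of the bijectivity only the inclusion of the image is kept: the operator glued from such
  pieces is shown to be injective through the forms.\<close>

lemma congruent_on_imp_isometry:
  assumes "congruent_on scale1 \<beta>1 V1 scale2 \<beta>2 V2"
  shows "\<exists>T. (\<forall>u\<in>V2. T u \<in> V1) \<and> (\<forall>u\<in>V2. \<forall>v\<in>V2. T (u + v) = T u + T v) \<and>
    (\<forall>a. \<forall>v\<in>V2. T (scale2 a v) = scale1 a (T v)) \<and> (\<forall>u\<in>V2. \<forall>v\<in>V2. \<beta>1 (T u) (T v) = \<beta>2 u v)"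
proof -
  obtain T where "bij_betw T V2 V1" and T: "(\<forall>u\<in>V2. \<forall>v\<in>V2. T (u + v) = T u + T v) \<and>
    (\<forall>a. \<forall>v\<in>V2. T (scale2 a v) = scale1 a (T v)) \<and> (\<forall>u\<in>V2. \<forall>v\<in>V2. \<beta>1 (T u) (T v) = \<beta>2 u v)"
    using assms unfolding congruent_on_def by (elim exE conjE) (rule that, assumption, intro conjI)
  moreover from this(1) have "\<forall>u\<in>V2. T u \<in> V1"
    by (auto dest: bij_betw_apply)
  ultimately show ?thesis
    by (intro exI[of _ T] conjI) simp_all
qed

section \<open>Invariant forms and the spectral pieces\<close>

context finite_order_operator
begin

lemma D_adjoint:
  assumes "biadditive \<beta>" "\<And>u v. \<beta> (X u) (X v) = \<beta> u v"
  shows "\<beta> (D u) v = - \<beta> u (D v)"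
  by (simp add: D_def biadditive_simps[OF assms(1)] isometry_adjoint[of \<beta> X X', OF assms(2) X_X'])

text \<open>\<open>D\<close> is skew-adjoint, so two applications of it cross the form without a
  sign.\<close>

lemma D_pow_adjoint:
  assumes "biadditive \<beta>" "\<And>u v. \<beta> (X u) (X v) = \<beta> u v"
  shows "\<beta> ((D ^^ (2 * N)) u) v = \<beta> u ((D ^^ (2 * N)) v)"
proof (induction N arbitrary: u v)
  case (Suc N)
  have pow: "(D ^^ (2 * Suc N)) w = D (D ((D ^^ (2 * N)) w))" for w
    by simp
  have "D (D ((D ^^ (2 * N)) u)) = (D ^^ (2 * N)) (D (D u))"
    by (simp only: D_pow_commute[of D, OF refl])
  then have "\<beta> ((D ^^ (2 * Suc N)) u) v = \<beta> ((D ^^ (2 * N)) (D (D u))) v"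
    by (simp only: pow)
  also have "\<dots> = \<beta> (D (D u)) ((D ^^ (2 * N)) v)"
    by (rule Suc.IH)
  also have "\<dots> = \<beta> u (D (D ((D ^^ (2 * N)) v)))"
    by (simp only: D_adjoint[of \<beta>, OF assms] minus_minus)
  finally show ?case
    by (simp only: pow)
qed simp

lemma eigenspace_iff: "v \<in> eigenspace scale X c \<longleftrightarrow> X v = scale c v"
  by (simp add: eigenspace_def)

lemma subspace_eigenspace: "subspace (eigenspace scale X c)"
  by (auto simp: subspace_def eigenspace_iff X_simps scale_right_distrib mult.commute)

lemma D_eigenvector:
  assumes "X v = v \<or> X v = - v"
  shows "D v = 0"
proof -
  have "X (X v) = v"
    using assms by (auto simp: X_simps)
  then have "X v = X' v"
    by (metis X'_X)
  then show ?thesis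
    by (simp add: D_def)
qed

text \<open>Invariance gives \<open>\<beta> u v = - \<beta> u v\<close>, and 2 is
  invertible.\<close>

lemma eigenspaces_orthogonal:
  assumes \<beta>: "biadditive (\<beta> :: 'v \<Rightarrow> 'v \<Rightarrow> 'f)" "\<And>u v. \<beta> (X u) (X v) = \<beta> u v"
    and "(1 :: 'f) + 1 \<noteq> 0" "X u = u" "X v = - v"
  shows "\<beta> u v = 0" "\<beta> v u = 0"
proof -
  have zero: "x = 0" if "- x = x" for x :: 'f
  proof -
    have "x + x = - x + x"
      by (simp only: that)
    then have "(1 + 1) * x = 0"
      by (simp only: distrib_right mult_1_left add.left_inverse)
    then show ?thesis
      using assms(3) by simp
  qed
  have "- \<beta> u v = \<beta> u v" "- \<beta> v u = \<beta> v u"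
    using \<beta>(2)[of u v] \<beta>(2)[of v u] by (simp_all only: assms(4,5) biadditive_simps[OF \<beta>(1)])
  then show "\<beta> u v = 0" "\<beta> v u = 0"
    by (simp_all only: zero)
qed

text \<open>A vector \<open>u\<close> of the eigenspace is orthogonal to the range of
  \<open>D ^^ (2 * N)\<close>, which is self-adjoint and kills \<open>u\<close>, and to the other
  eigenspace. If it is also orthogonal to its own eigenspace, it lies in the radical of the whole
  form.\<close>

lemma eigenspace_nondegenerate:
  assumes \<beta>: "biadditive (\<beta> :: 'v \<Rightarrow> 'v \<Rightarrow> 'f)" "\<And>u v. \<beta> (X u) (X v) = \<beta> u v" "nondegenerate \<beta>"
    and c: "c = 1 \<or> c = -1"
  shows "nondegenerate_on \<beta> (eigenspace scale X c)"
  unfolding nondegenerate_on_def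
proof (intro ballI impI)
  fix u assume u: "u \<in> eigenspace scale X c" and orth: "\<forall>v\<in>eigenspace scale X c. \<beta> u v = 0"
  obtain N P Q where "\<And>v. (D ^^ (2 * N)) ((D ^^ (2 * N)) v) = (D ^^ (2 * N)) v"
    and dec1: "\<And>v. D v = 0 \<Longrightarrow> (D ^^ (2 * N)) v = 0"
    and "additive P" "\<And>c v. P (scale c v) = scale c (P v)" "\<And>v. P (X v) = X (P v)" and dec2: "\<And>v. X (P v) = P v"
    and "additive Q" "\<And>c v. Q (scale c v) = scale c (Q v)" "\<And>v. Q (X v) = X (Q v)" and dec3: "\<And>v. X (Q v) = - Q v"
    and dec4: "\<And>v. v = (D ^^ (2 * N)) v + P v + Q v"
    and dec5: "(1 :: 'f) + 1 \<noteq> 0 \<or> (\<forall>v. Q v = 0)"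
    by (rule spectral_decomposition) (rule that; assumption)
  have Xu: "X u = u \<or> X u = - u"
    using u c by (auto simp: eigenspace_iff)
  have "\<beta> u v = 0" for v
  proof -
    have "\<beta> u v = \<beta> u ((D ^^ (2 * N)) v) + \<beta> u (P v) + \<beta> u (Q v)"
      by (subst dec4[of v]) (simp add: biadditive_simps[OF \<beta>(1)])
    also have "\<beta> u ((D ^^ (2 * N)) v) = 0"
      using dec1[OF D_eigenvector[OF Xu]]
      by (simp add: biadditive_simps[OF \<beta>(1)] flip: D_pow_adjoint[of \<beta>, OF \<beta>(1,2)])
    also have "\<beta> u (P v) = 0"
    proof (cases "(1 :: 'f) + 1 = 0 \<or> c = 1")
      case True
      \<comment> \<open>In characteristic two \<open>-1 = 1\<close>, so both alternatives lead to
        the eigenvalue 1.\<close>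
      then have "c = 1"
        using c minus_unique[of "1 :: 'f" 1] by auto
      then show ?thesis
        using orth dec2 by (simp add: eigenspace_iff)
    next
      case False
      then show ?thesis
        using eigenspaces_orthogonal(2)[of \<beta>, OF \<beta>(1,2), of "P v" u] dec2 u c by (auto simp: eigenspace_iff)
    qed
    also have "\<beta> u (Q v) = 0"
    proof (cases "(1 :: 'f) + 1 = 0")
      case True
      then show ?thesis
        using dec5 by (auto simp: biadditive_simps[OF \<beta>(1)])
    next
      case False
      show ?thesis
      proof (cases "c = 1")
        case True
        then show ?thesis
          using eigenspaces_orthogonal(1)[of \<beta>, OF \<beta>(1,2) False, of u "Q v"] dec3 u by (simp add: eigenspace_iff)
      next
        case False
        then show ?thesis
          using orth c dec3 by (simp add: eigenspace_iff)
      qed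
    qed
    finally show ?thesis
      by simp
  qed
  then show "u = 0"
    using \<beta>(3) by (simp add: nondegenerate_def)
qed

end

section \<open>Equivariant isometries\<close>

text \<open>\<open>T\<close> is glued along the orthogonal splitting: the solution \<open>b\<close>
  of the norm equation acts on the range of \<open>e\<close>, the given congruences \<open>S\<close>
  and \<open>S'\<close> on the two eigenspaces, where equivariance is automatic because
  \<open>X\<close> is a scalar.\<close>

lemma equivariant_isometry_bilinear:
  fixes scale :: "'f::{field,finite} \<Rightarrow> 'v::ab_group_add \<Rightarrow> 'v"
  assumes fd: "finite_dimensional_vector_space scale Basis" and op: "finite_order_operator scale X X' n"
    and \<beta>: "sesquilinear scale id \<beta>" "\<And>u v. \<beta> v u = \<phi> (\<beta> u v)" "nondegenerate \<beta>"
    and \<gamma>: "sesquilinear scale id \<gamma>" "\<And>u v. \<gamma> v u = \<phi> (\<gamma> u v)" "nondegenerate \<gamma>"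
    and X\<beta>: "\<And>u v. \<beta> (X u) (X v) = \<beta> u v" and X\<gamma>: "\<And>u v. \<gamma> (X u) (X v) = \<gamma> u v"
    and cong: "\<And>c. c \<in> {1, -1} \<Longrightarrow>
      congruent_on scale \<beta> (eigenspace scale X c) scale \<gamma> (eigenspace scale X c)"
  shows "\<exists>T. additive T \<and> (\<forall>c v. T (scale c v) = scale c (T v)) \<and> (\<forall>v. T (X v) = X (T v)) \<and>
    (\<forall>u v. \<beta> (T u) (T v) = \<gamma> u v)"
proof -
  interpret finite_order_operator scale X X' n
    by (rule op)
  note s\<beta> = sesquilinear_simps[OF \<beta>(1)] and s\<gamma> = sesquilinear_simps[OF \<gamma>(1)]
  note fq = form_quotient[OF fd \<beta>(1) _ \<beta>(3) \<gamma>(1) _ \<gamma>(3), where \<phi> = \<phi>, OF \<beta>(2) \<gamma>(2)]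
  obtain A where A: "additive A" "\<And>c v. A (scale c v) = scale c (A v)" "\<And>v. A v = 0 \<Longrightarrow> v = 0"
    "\<And>u v. \<beta> (A u) v = \<gamma> u v" "\<And>u v. \<beta> u (A v) = \<gamma> u v"
    and A_comm: "\<forall>Z Z'. (\<forall>u v. \<beta> (Z' u) v = \<beta> u (Z v)) \<longrightarrow> (\<forall>u v. \<gamma> (Z' u) v = \<gamma> u (Z v)) \<longrightarrow>
      (\<forall>v. A (Z v) = Z (A v))"
    by (rule fq) (rule that; assumption)
  obtain N P Q where idem: "\<And>v. (D ^^ (2 * N)) ((D ^^ (2 * N)) v) = (D ^^ (2 * N)) v"
    and ker: "\<And>v. D v = 0 \<Longrightarrow> (D ^^ (2 * N)) v = 0"
    and P: "additive P" "\<And>c v. P (scale c v) = scale c (P v)" "\<And>v. P (X v) = X (P v)" "\<And>v. X (P v) = P v"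
    and Q: "additive Q" "\<And>c v. Q (scale c v) = scale c (Q v)" "\<And>v. Q (X v) = X (Q v)" "\<And>v. X (Q v) = - Q v"
    and sum: "\<And>v. v = (D ^^ (2 * N)) v + P v + Q v"
    and Q0: "(1 :: 'f) + 1 \<noteq> 0 \<or> (\<forall>v. Q v = 0)"
    by (rule spectral_decomposition) (rule that; assumption)
  define e where "e = D ^^ (2 * N)"
  have e: "additive e" "\<And>c v. e (scale c v) = scale c (e v)" "\<And>v. e (e v) = e v"
    "\<And>v. D v = 0 \<Longrightarrow> e v = 0" "\<And>v. v = e v + P v + Q v"
    unfolding e_def by (rule D_pow_additive D_pow_scale idem sum | (rule ker, assumption))+
  have e_inj: "v = 0" if "e v = v" "D v = 0" for v
    using e(4) that by metis
  have e_adj: "\<beta> (e u) v = \<beta> u (e v)" "\<gamma> (e u) v = \<gamma> u (e v)" for u v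
    using D_pow_adjoint[of \<beta>, OF s\<beta>(1) X\<beta>] D_pow_adjoint[of \<gamma>, OF s\<gamma>(1) X\<gamma>] by (simp_all add: e_def)
  note X_adj = isometry_adjoint[of \<beta> X X', OF X\<beta> X_X'] isometry_adjoint[of \<gamma> X X', OF X\<gamma> X_X']
  have AX: "A (X v) = X (A v)" "A (X' v) = X' (A v)" for v
    using A_comm[rule_format, of X' X] A_comm[rule_format, of X X'] X_adj by auto
  have AD: "A (D v) = D (A v)" and X_D: "X (D v) = D (X v)" "X' (D v) = D (X' v)" for v
    by (simp_all add: D_def AX additive_simps[OF A(1)] X_simps X'_simps)
  have e_comm: "e (A v) = A (e v)" "e (X v) = X (e v)" "e (X' v) = X' (e v)" "e (D v) = D (e v)" for v
    using D_pow_commute[of A] D_pow_commute[of X] D_pow_commute[of X'] D_pow_commute[of D] AD X_D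
    by (simp_all add: e_def)
  have A_adj: "\<beta> (A u) v = \<beta> u (A v)" for u v
    by (simp add: A)
  have A_inj: "v = 0" if "e v = v" "A v = 0" for v
    using A(3) that(2) .
  have "\<exists>b. additive b \<and> (\<forall>c v. b (scale c v) = scale c (b v)) \<and> (\<forall>v. b (X v) = X (b v)) \<and>
      (\<forall>v. b (e v) = e (b v)) \<and> (\<forall>u v. \<beta> (b u) (b v) = \<beta> (A (e u)) v)"
  proof (cases "(1 :: 'f) + 1 = 0")
    case True
    have dbl: "v + v = 0" for v :: 'v
    proof -
      have "v + v = scale (1 + 1) v"
        by (simp only: scale_left_distrib scale_one)
      then show ?thesis
        by (simp only: True scale_zero_left)
    qed
    \<comment> \<open>With \<open>W = X\<close> the cross coefficient \<open>X + X'\<close> equals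
      \<open>D\<close> in characteristic two, and \<open>D\<close> is injective on the range of
      \<open>e\<close>.\<close>
    have neg: "v = 0" if "e v = v" "X v + X' v = 0" for v
    proof (rule e_inj[OF that(1)])
      have "X v = X' v"
        using that(2) dbl[of "X' v"] by (metis add_right_cancel)
      then show "D v = 0"
        by (simp add: D_def)
    qed
    have comm: "{X, X', A, e} \<subseteq> centralizer {X, X', A, e}"
      using X_additive X'_additive A(1) e(1) by (auto simp: centralizer_def AX e_comm)
    have W: "(\<forall>v::'v. v + v = 0) \<and> (\<forall>v. e v = v \<longrightarrow> X v + X' v = 0 \<longrightarrow> v = 0) \<or>
      (\<forall>v::'v. v + v = 0 \<longrightarrow> v = 0) \<and> (\<forall>v. X' v = - X v) \<and> (\<forall>v. e v = v \<longrightarrow> X v = 0 \<longrightarrow> v = 0)"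
      using neg dbl by blast
    from selfadjoint_is_norm[of \<beta> X X' A e, OF fin s\<beta>(1) comm X_adj(1,2) A_adj e_adj(1) e(3) A_inj W]
    obtain b where b: "additive b" "\<And>Z v. Z \<in> centralizer {X, X', A, e} \<Longrightarrow> b (Z v) = Z (b v)"
      "\<And>u v. \<beta> (b u) (b v) = \<beta> (A (e u)) v"
      by blast
    have "X \<in> centralizer {X, X', A, e}" "e \<in> centralizer {X, X', A, e}"
      "scale c \<in> centralizer {X, X', A, e}" for c
      using X_additive e(1)
      by (auto simp: centralizer_def AX e_comm A(2) e(2) X_simps X'_simps additive_def scale_right_distrib)
    then show ?thesis
      using b by blast
  next
    case False
    \<comment> \<open>Here \<open>W = D\<close>, whose adjoint is \<open>- D\<close>; this puts the
      equation into the form without cross term.\<close>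
    let ?D' = "\<lambda>v. - D v"
    have two: "v = 0" if "v + v = 0" for v :: 'v
    proof -
      have "scale (1 + 1) v = 0"
        using that by (simp only: scale_left_distrib scale_one)
      then show ?thesis
        using False by (simp only: scale_eq_0_iff) simp
    qed
    have D'_additive: "additive ?D'"
      using D_additive by (simp add: additive_def)
    have D_adj: "\<beta> (D u) v = \<beta> u (- D v)" "\<beta> (- D u) v = \<beta> u (D v)" for u v
      by (simp_all add: D_adjoint[of \<beta>, OF s\<beta>(1) X\<beta>] s\<beta>)
    have comm: "{D, ?D', A, e} \<subseteq> centralizer {D, ?D', A, e}"
      using D_additive D'_additive A(1) e(1)
      by (auto simp: centralizer_def AD e_comm additive_simps)
    have W: "(\<forall>v::'v. v + v = 0) \<and> (\<forall>v. e v = v \<longrightarrow> D v + ?D' v = 0 \<longrightarrow> v = 0) \<or>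
      (\<forall>v::'v. v + v = 0 \<longrightarrow> v = 0) \<and> (\<forall>v. ?D' v = - D v) \<and> (\<forall>v. e v = v \<longrightarrow> D v = 0 \<longrightarrow> v = 0)"
      using e_inj two by blast
    from selfadjoint_is_norm[of \<beta> D "?D'" A e, OF fin s\<beta>(1) comm D_adj A_adj e_adj(1) e(3) A_inj W]
    obtain b where b: "additive b" "\<And>Z v. Z \<in> centralizer {D, ?D', A, e} \<Longrightarrow> b (Z v) = Z (b v)"
      "\<And>u v. \<beta> (b u) (b v) = \<beta> (A (e u)) v"
      by blast
    have "X \<in> centralizer {D, ?D', A, e}" "e \<in> centralizer {D, ?D', A, e}"
      "scale c \<in> centralizer {D, ?D', A, e}" for c
      using X_additive e(1)
      by (auto simp: centralizer_def AX X_D e_comm A(2) e(2) X_simps D_scale additive_simps[OF e(1)]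
          additive_def scale_right_distrib)
    then show ?thesis
      using b by blast
  qed
  then obtain b where b: "additive b" "\<And>c v. b (scale c v) = scale c (b v)" "\<And>v. b (X v) = X (b v)"
    "\<And>v. b (e v) = e (b v)" "\<And>u v. \<beta> (b u) (b v) = \<beta> (A (e u)) v"
    by blast
  let ?E = "eigenspace scale X"
  obtain S where S: "\<forall>u\<in>?E 1. S u \<in> ?E 1" "\<forall>u\<in>?E 1. \<forall>v\<in>?E 1. S (u + v) = S u + S v"
      "\<forall>a. \<forall>v\<in>?E 1. S (scale a v) = scale a (S v)" "\<forall>u\<in>?E 1. \<forall>v\<in>?E 1. \<beta> (S u) (S v) = \<gamma> u v"
    using congruent_on_imp_isometry[OF cong[of 1]] by auto
  obtain S' where S': "\<forall>u\<in>?E (-1). S' u \<in> ?E (-1)" "\<forall>u\<in>?E (-1). \<forall>v\<in>?E (-1). S' (u + v) = S' u + S' v"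
      "\<forall>a. \<forall>v\<in>?E (-1). S' (scale a v) = scale a (S' v)" "\<forall>u\<in>?E (-1). \<forall>v\<in>?E (-1). \<beta> (S' u) (S' v) = \<gamma> u v"
    using congruent_on_imp_isometry[OF cong[of "-1"]] by auto
  note S = S[rule_format] and S' = S'[rule_format]
  have PE: "P v \<in> ?E 1" and QE: "Q v \<in> ?E (-1)" for v
    using P Q by (simp_all add: eigenspace_iff)
  define T where "T v = b (e v) + S (P v) + S' (Q v)" for v
  have SP: "X (S (P v)) = S (P v)" and SQ: "X (S' (Q v)) = - S' (Q v)" for v
    using S(1)[OF PE] S'(1)[OF QE] by (simp_all add: eigenspace_iff)
  have S'_minus: "S' (- Q v) = - S' (Q v)" for v
    using S'(3)[OF QE, of "-1" v] by simp
  have S'_0: "S' 0 = 0"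
    using S'(3)[OF QE, of 0 undefined] by simp
  have "additive T"
    unfolding additive_def T_def
    by (simp add: additive_simps[OF b(1)] additive_simps[OF e(1)] additive_simps(1)[OF P(1)]
        additive_simps(1)[OF Q(1)] S(2)[OF PE PE] S'(2)[OF QE QE] add_ac)
  moreover have "T (scale c v) = scale c (T v)" for c v
    by (simp add: T_def b(2) e(2) P(2) Q(2) S(3)[OF PE] S'(3)[OF QE] scale_right_distrib)
  moreover have "T (X v) = X (T v)" for v
    by (simp add: T_def b(3) e_comm P(3,4) Q(3,4) X_simps SP SQ S'_minus)
  moreover have "\<beta> (T u) (T v) = \<gamma> u v" for u v
  proof -
    \<comment> \<open>Eigenvectors for 1 and -1 lie in the kernel of \<open>D\<close> and are killed
      by the self-adjoint \<open>e\<close>, so they are orthogonal to its range; \<open>b\<close>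
      preserves that range because it commutes with \<open>e\<close>.\<close>
    have orth: "\<beta> (b (e x)) s = 0" "\<beta> s (b (e x)) = 0" "\<gamma> (e x) s = 0" "\<gamma> s (e x) = 0"
      if "X s = s \<or> X s = - s" for x s
    proof -
      have "e s = 0"
        using e(4) D_eigenvector[OF that] by blast
      then show "\<beta> (b (e x)) s = 0" "\<beta> s (b (e x)) = 0" "\<gamma> (e x) s = 0" "\<gamma> s (e x) = 0"
        by (simp_all add: b(4) e_adj s\<beta> s\<gamma>) (simp_all add: s\<beta> s\<gamma> flip: e_adj)
    qed
    have cross: "\<beta> (S (P x)) (S' (Q y)) = 0 \<and> \<beta> (S' (Q y)) (S (P x)) = 0 \<and>
        \<gamma> (P x) (Q y) = 0 \<and> \<gamma> (Q y) (P x) = 0" for x y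
    proof (cases "\<forall>v. Q v = 0")
      case False
      then have two: "(1 :: 'f) + 1 \<noteq> 0"
        using Q0 by blast
      show ?thesis
        using eigenspaces_orthogonal[of \<beta>, OF s\<beta>(1) X\<beta> two SP SQ]
          eigenspaces_orthogonal[of \<gamma>, OF s\<gamma>(1) X\<gamma> two P(4) Q(4)] by blast
    qed (simp add: s\<beta> s\<gamma> S'_0)
    have main: "\<beta> (b (e u)) (b (e v)) = \<gamma> (e u) (e v)"
      by (simp add: b(5) e(3) A(4))
    have "\<beta> (T u) (T v) = \<gamma> (e u) (e v) + \<gamma> (P u) (P v) + \<gamma> (Q u) (Q v)"
      using orth[of "S (P u)"] orth[of "S (P v)"] orth[of "S' (Q u)"] orth[of "S' (Q v)"] SP SQ
      by (simp add: T_def s\<beta> cross main S(4)[OF PE PE] S'(4)[OF QE QE])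
    also have "\<dots> = \<gamma> (e u + P u + Q u) (e v + P v + Q v)"
      using orth[of "P u"] orth[of "P v"] orth[of "Q u"] orth[of "Q v"] P(4) Q(4)
      by (simp add: s\<gamma> cross)
    also have "\<dots> = \<gamma> u v"
      using e(5)[of u] e(5)[of v] by simp
    finally show ?thesis .
  qed
  ultimately show ?thesis
    by (intro exI[of _ T] conjI allI)
qed

text \<open>Multiplication by \<open>a\<close> has multiplication by \<open>\<psi> a\<close> as its
  adjoint, and the two differ by a nonzero scalar on the whole space; hence \<open>e = id\<close>
  and no eigenvalue is exceptional. The involution law for \<open>a\<close> is stated on values of
  the form, where hermitian symmetry delivers it.\<close>

lemma equivariant_isometry_hermitian:
  fixes scale :: "'f::{field,finite} \<Rightarrow> 'v::ab_group_add \<Rightarrow> 'v"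
  assumes fd: "finite_dimensional_vector_space scale Basis"
    and X: "additive X" "\<And>c v. X (scale c v) = scale c (X v)" "\<And>v. X (X' v) = v"
    and \<beta>: "sesquilinear scale \<psi> \<beta>" "\<And>u v. \<beta> v u = \<phi> (\<beta> u v)" "nondegenerate \<beta>"
    and \<gamma>: "sesquilinear scale \<psi> \<gamma>" "\<And>u v. \<gamma> v u = \<phi> (\<gamma> u v)" "nondegenerate \<gamma>"
    and X\<beta>: "\<And>u v. \<beta> (X u) (X v) = \<beta> u v" and X\<gamma>: "\<And>u v. \<gamma> (X u) (X v) = \<gamma> u v"
    and \<psi>: "\<psi> a \<noteq> a" "\<And>u v. \<psi> (\<psi> a) * \<beta> u v = a * \<beta> u v"
  shows "\<exists>T. additive T \<and> (\<forall>c v. T (scale c v) = scale c (T v)) \<and> (\<forall>v. T (X v) = X (T v)) \<and>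
    (\<forall>u v. \<beta> (T u) (T v) = \<gamma> u v)"
proof -
  interpret finite_dimensional_vector_space scale Basis
    by (rule fd)
  note fin = finite_UNIV_vector_space[OF fd]
  note s\<beta> = sesquilinear_simps[OF \<beta>(1)] and s\<gamma> = sesquilinear_simps[OF \<gamma>(1)]
  note fq = form_quotient[OF fd \<beta>(1) _ \<beta>(3) \<gamma>(1) _ \<gamma>(3), where \<phi> = \<phi>, OF \<beta>(2) \<gamma>(2)]
  obtain A where A: "additive A" "\<And>c v. A (scale c v) = scale c (A v)" "\<And>v. A v = 0 \<Longrightarrow> v = 0"
    "\<And>u v. \<beta> (A u) v = \<gamma> u v" "\<And>u v. \<beta> u (A v) = \<gamma> u v"
    and A_comm: "\<forall>Z Z'. (\<forall>u v. \<beta> (Z' u) v = \<beta> u (Z v)) \<longrightarrow> (\<forall>u v. \<gamma> (Z' u) v = \<gamma> u (Z v)) \<longrightarrow>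
      (\<forall>v. A (Z v) = Z (A v))"
    by (rule fq) (rule that; assumption)
  note X_adj = isometry_adjoint[of \<beta> X X', OF X\<beta> X(3)] isometry_adjoint[of \<gamma> X X', OF X\<gamma> X(3)]
  have AX: "A (X v) = X (A v)" for v
    using A_comm[rule_format, of X' X] X_adj by auto
  have A_adj: "\<beta> (A u) v = \<beta> u (A v)" for u v
    by (simp add: A)
  have A_inj: "v = 0" if "id v = v" "A v = 0" for v
    using A(3) that(2) .
  have id_id: "id (id v) = id v" for v :: 'v
    by simp
  have id_comm: "{W, W', A, id} \<subseteq> centralizer {W, W', A, id}"
    if "additive W" "additive W'" "\<And>v. W (W' v) = W' (W v)" "\<And>v. A (W v) = W (A v)" "\<And>v. A (W' v) = W' (A v)"
    for W W'
    using that A(1) by (auto simp: centralizer_def additive_def)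
  have id_adj: "\<beta> (id u) v = \<beta> u (id v)" for u v
    by simp
  have "\<exists>b. additive b \<and> (\<forall>c v. b (scale c v) = scale c (b v)) \<and> (\<forall>v. b (X v) = X (b v)) \<and>
      (\<forall>u v. \<beta> (b u) (b v) = \<beta> (A (id u)) v)"
  proof (cases "(1 :: 'f) + 1 = 0")
    case True
    \<comment> \<open>The cross coefficient is the scalar \<open>a + \<psi> a\<close>, equal to the
      nonzero \<open>a - \<psi> a\<close> in characteristic two.\<close>
    let ?W = "scale a" and ?W' = "scale (\<psi> a)"
    have dbl: "v + v = 0" for v :: 'v
    proof -
      have "v + v = scale (1 + 1) v"
        by (simp only: scale_left_distrib scale_one)
      then show ?thesis
        by (simp only: True scale_zero_left)
    qed
    have inj: "v = 0" if "?W v + ?W' v = 0" for v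
    proof -
      have "scale a v = scale (\<psi> a) v"
        using that dbl[of "scale (\<psi> a) v"] by (metis add_right_cancel)
      then show ?thesis
        using \<psi>(1) by (metis scale_cancel_right)
    qed
    have W_additive: "additive ?W" "additive ?W'"
      by (simp_all add: additive_def scale_right_distrib)
    have W_adj: "\<beta> (?W u) v = \<beta> u (?W' v)" "\<beta> (?W' u) v = \<beta> u (?W v)" for u v
      by (simp_all add: s\<beta> \<psi>(2))
    have comm: "{?W, ?W', A, id} \<subseteq> centralizer {?W, ?W', A, id}"
      by (rule id_comm[of ?W ?W']) (simp_all add: W_additive A(2) mult.commute)
    have W: "(\<forall>v::'v. v + v = 0) \<and> (\<forall>v. id v = v \<longrightarrow> ?W v + ?W' v = 0 \<longrightarrow> v = 0) \<or>
      (\<forall>v::'v. v + v = 0 \<longrightarrow> v = 0) \<and> (\<forall>v. ?W' v = - ?W v) \<and> (\<forall>v. id v = v \<longrightarrow> ?W v = 0 \<longrightarrow> v = 0)"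
      using inj dbl by blast
    from selfadjoint_is_norm[of \<beta> "?W" "?W'" A id, OF fin s\<beta>(1) comm W_adj A_adj id_adj id_id A_inj W]
    obtain b where b: "additive b" "\<And>Z v. Z \<in> centralizer {?W, ?W', A, id} \<Longrightarrow> b (Z v) = Z (b v)"
      "\<And>u v. \<beta> (b u) (b v) = \<beta> (A (id u)) v"
      by blast
    have "X \<in> centralizer {?W, ?W', A, id}" "scale c \<in> centralizer {?W, ?W', A, id}" for c
      using X(1) by (auto simp: centralizer_def AX A(2) X(2) additive_def scale_right_distrib mult.commute)
    then show ?thesis
      using b by blast
  next
    case False
    \<comment> \<open>The scalar \<open>a - \<psi> a\<close> is nonzero and is negated by the
      conjugation, so it acts as an invertible skew operator.\<close>
    let ?W = "\<lambda>v. scale a v - scale (\<psi> a) v" and ?W' = "\<lambda>v. - (scale a v - scale (\<psi> a) v)"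
    have two: "v = 0" if "v + v = 0" for v :: 'v
    proof -
      have "scale (1 + 1) v = 0"
        using that by (simp only: scale_left_distrib scale_one)
      then show ?thesis
        using False by (simp only: scale_eq_0_iff) simp
    qed
    have inj: "v = 0" if "?W v = 0" for v
      using that \<psi>(1) by (metis scale_cancel_right right_minus_eq)
    have W_additive: "additive ?W" "additive ?W'"
      by (auto simp: additive_def scale_right_distrib)
    have W_adj: "\<beta> (?W u) v = \<beta> u (?W' v)" "\<beta> (?W' u) v = \<beta> u (?W v)" for u v
      by (simp_all add: s\<beta> \<psi>(2))
    have comm: "{?W, ?W', A, id} \<subseteq> centralizer {?W, ?W', A, id}"
      by (rule id_comm[of ?W ?W'], rule W_additive(1), rule W_additive(2))
        (simp_all add: W_additive A(2) additive_simps[OF A(1)] scale_right_diff_distrib mult.commute)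
    have W: "(\<forall>v::'v. v + v = 0) \<and> (\<forall>v. id v = v \<longrightarrow> ?W v + ?W' v = 0 \<longrightarrow> v = 0) \<or>
      (\<forall>v::'v. v + v = 0 \<longrightarrow> v = 0) \<and> (\<forall>v. ?W' v = - ?W v) \<and> (\<forall>v. id v = v \<longrightarrow> ?W v = 0 \<longrightarrow> v = 0)"
      using inj two by blast
    from selfadjoint_is_norm[of \<beta> "?W" "?W'" A id, OF fin s\<beta>(1) comm W_adj A_adj id_adj id_id A_inj W]
    obtain b where b: "additive b" "\<And>Z v. Z \<in> centralizer {?W, ?W', A, id} \<Longrightarrow> b (Z v) = Z (b v)"
      "\<And>u v. \<beta> (b u) (b v) = \<beta> (A (id u)) v"
      by blast
    have "X \<in> centralizer {?W, ?W', A, id}" "scale c \<in> centralizer {?W, ?W', A, id}" for c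
      by (auto simp: centralizer_def AX A(2) X(2) additive_simps[OF X(1)] additive_def
          scale_right_distrib scale_right_diff_distrib mult.commute)
    then show ?thesis
      using b by blast
  qed
  then show ?thesis
    by (simp add: A(4))
qed

section \<open>Conjugacy of isometries\<close>

lemma conjugate_in_iff:
  assumes "group G" "x \<in> carrier G" "y \<in> carrier G"
  shows "conjugate_in G x y \<longleftrightarrow> (\<exists>g\<in>carrier G. g \<otimes>\<^bsub>G\<^esub> y = x \<otimes>\<^bsub>G\<^esub> g)"
proof -
  interpret group G by fact
  have "y = inv\<^bsub>G\<^esub> g \<otimes>\<^bsub>G\<^esub> x \<otimes>\<^bsub>G\<^esub> g \<longleftrightarrow> g \<otimes>\<^bsub>G\<^esub> y = x \<otimes>\<^bsub>G\<^esub> g" if g: "g \<in> carrier G" for g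
  proof -
    have "inv\<^bsub>G\<^esub> g \<otimes>\<^bsub>G\<^esub> x \<otimes>\<^bsub>G\<^esub> g = inv\<^bsub>G\<^esub> g \<otimes>\<^bsub>G\<^esub> (x \<otimes>\<^bsub>G\<^esub> g)"
      using assms g by (simp add: m_assoc)
    then show ?thesis
      using inv_solve_left[of y g "x \<otimes>\<^bsub>G\<^esub> g"] assms g by auto
  qed
  then show ?thesis
    by (auto simp: conjugate_in_def)
qed

lemma carrier_general_linear_iff:
  assumes "vector_space scale"
  shows "X \<in> carrier (general_linear scale) \<longleftrightarrow>
    additive X \<and> (\<forall>c v. X (scale c v) = scale c (X v)) \<and> bij X"
  using assms by (auto simp: general_linear_def Vector_Spaces.linear_iff additive_def)

lemma conjugate_in_general_linear:
  assumes "vector_space scale" "X \<in> carrier (general_linear scale)" "Y \<in> carrier (general_linear scale)"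
  shows "conjugate_in (general_linear scale) X Y \<longleftrightarrow>
    (\<exists>g\<in>carrier (general_linear scale). \<forall>v. Y (g v) = g (X v))"
  using conjugate_in_iff[OF group_general_linear[OF assms(1)] assms(2,3)]
  by (simp add: general_linear_def fun_eq_iff)

lemma conjugate_in_isometry_group:
  assumes "vector_space scale" "X \<in> carrier (isometry_group scale \<beta>)" "Y \<in> carrier (isometry_group scale \<beta>)"
  shows "conjugate_in (isometry_group scale \<beta>) X Y \<longleftrightarrow>
    (\<exists>g\<in>carrier (isometry_group scale \<beta>). \<forall>v. Y (g v) = g (X v))"
  using conjugate_in_iff[OF group_isometry_group[OF assms(1)] assms(2,3)]
  by (simp add: isometry_group_def general_linear_def fun_eq_iff)

lemma semisimple_finite_order_operator:
  fixes scale :: "'f::{field,finite} \<Rightarrow> 'v::ab_group_add \<Rightarrow> 'v"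
  assumes fd: "finite_dimensional_vector_space scale Basis" and X: "semisimple scale X"
  shows "finite_order_operator scale X (inv_into UNIV X) (group.ord (general_linear scale) X)"
proof -
  interpret finite_dimensional_vector_space scale Basis
    by (rule fd)
  interpret G: group "general_linear scale"
    by (rule group_general_linear) (rule vector_space_axioms)
  have XG: "X \<in> carrier (general_linear scale)"
    using X by (simp add: semisimple_def)
  then have X': "additive X" "\<And>c v. X (scale c v) = scale c (X v)" "bij X"
    using carrier_general_linear_iff[OF vector_space_axioms] by blast+
  have pow: "X [^]\<^bsub>general_linear scale\<^esub> k = X ^^ k" for k :: nat
    by (induction k) (simp_all add: general_linear_def)
  have "\<not> CHAR('f) dvd G.ord X"
  proof
    assume "CHAR('f) dvd G.ord X"
    moreover have "coprime (G.ord X) CHAR('f)"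
      using X by (simp add: semisimple_def)
    ultimately have "CHAR('f) dvd 1"
      by (intro coprime_common_divisor) auto
    then show False
      using prime_gt_1_nat[OF prime_CHAR_finite_field[where ?'f = 'f]] by simp
  qed
  then have "of_nat (G.ord X) \<noteq> (0 :: 'f)"
    by (simp add: of_nat_eq_0_iff_char_dvd)
  moreover have "(X ^^ G.ord X) v = v" for v
    using G.pow_ord_eq_1[OF XG] by (simp add: pow) (simp add: general_linear_def)
  ultimately show ?thesis
    using X' finite_UNIV_vector_space[OF fd]
    by unfold_locales (auto simp: additive_simps bij_is_surj surj_f_inv_f bij_is_inj)
qed

text \<open>\<open>T\<close> carries the pulled-back form to \<open>\<beta>\<close> and
  \<open>g\<close> does the same, so following the inverse of \<open>T\<close> by \<open>g\<close>
  preserves \<open>\<beta>\<close>. It still conjugates \<open>X\<close> to \<open>Y\<close> because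
  \<open>T\<close> commutes with \<open>X\<close>. Non-degeneracy makes \<open>T\<close> injective,
  finiteness makes it bijective.\<close>

lemma isometry_conjugator:
  fixes scale :: "'f::field \<Rightarrow> 'v::ab_group_add \<Rightarrow> 'v"
  assumes vs: "vector_space scale" and fin: "finite (UNIV :: 'v set)"
    and \<beta>: "biadditive \<beta>" "nondegenerate \<beta>"
    and g: "g \<in> carrier (general_linear scale)" "\<And>v. Y (g v) = g (X v)"
    and T: "additive T" "\<And>c v. T (scale c v) = scale c (T v)" "\<And>v. T (X v) = X (T v)"
      "\<And>u v. \<beta> (T u) (T v) = \<beta> (g u) (g v)"
  shows "\<exists>h\<in>carrier (isometry_group scale \<beta>). \<forall>v. Y (h v) = h (X v)"
proof -
  note gl = carrier_general_linear_iff[OF vs]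
  interpret G: group "general_linear scale"
    by (rule group_general_linear[OF vs])
  have g': "additive g" "bij g"
    using g(1) gl by blast+
  have "inj T"
  proof (rule injI)
    fix x y assume "T x = T y"
    then have "\<beta> (g (x - y)) (g v) = 0" for v
      using T(4)[of "x - y" v] by (simp add: additive_simps[OF T(1)] biadditive_simps[OF \<beta>(1)])
    then have "\<beta> (g (x - y)) w = 0" for w
      using bij_is_surj[OF g'(2)] by (metis surjD)
    then have "g (x - y) = 0"
      using \<beta>(2) by (simp add: nondegenerate_def)
    then have "g x = g y"
      by (simp add: additive_simps[OF g'(1)])
    then show "x = y"
      using bij_is_inj[OF g'(2)] by (simp add: inj_eq)
  qed
  then have TG: "T \<in> carrier (general_linear scale)"
    using T finite_UNIV_inj_surj[OF fin] by (auto simp: gl bij_def)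
  let ?T' = "inv\<^bsub>general_linear scale\<^esub> T"
  have mult: "(P \<otimes>\<^bsub>general_linear scale\<^esub> R) v = R (P v)" "\<one>\<^bsub>general_linear scale\<^esub> v = v" for P R v
    by (simp_all add: general_linear_def)
  have T': "?T' \<in> carrier (general_linear scale)" "T (?T' v) = v" "?T' (T v) = v" for v
    using G.inv_closed[OF TG] fun_cong[OF G.l_inv[OF TG], of v] fun_cong[OF G.r_inv[OF TG], of v]
    unfolding mult by blast+
  define h where "h = ?T' \<otimes>\<^bsub>general_linear scale\<^esub> g"
  have h: "h v = g (?T' v)" for v
    by (simp add: h_def mult)
  have "h \<in> carrier (general_linear scale)"
    using T'(1) g(1) by (simp add: h_def)
  moreover have "\<beta> (h u) (h v) = \<beta> u v" for u v
    using T(4)[of "?T' u" "?T' v"] by (simp only: h T'(2))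
  moreover have "Y (h v) = h (X v)" for v
  proof -
    have "?T' (X v) = X (?T' v)"
      using T'(3)[of "X (?T' v)"] by (simp only: T(3) T'(2))
    then show ?thesis
      by (simp add: h g(2))
  qed
  ultimately show ?thesis
    by (intro bexI[of _ h]) (simp_all add: isometry_group_def)
qed

section \<open>The three kinds of forms and their pullbacks\<close>

lemma alternating_form_sesquilinear:
  assumes "alternating_form scale \<beta>"
  shows "sesquilinear scale id \<beta>" "\<beta> v v = 0" "\<beta> v u = - \<beta> u v"
proof -
  show s: "sesquilinear scale id \<beta>" and a: "\<beta> v v = 0" for v
    using assms by (auto simp: alternating_form_def bilinear_form_def Vector_Spaces.linear_iff
        sesquilinear_def biadditive_def additive_def)
  show "\<beta> v u = - \<beta> u v"
    by (rule alternating_skew[OF sesquilinear_simps(1)[OF s] a])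
qed

lemma symmetric_form_sesquilinear:
  assumes "symmetric_form scale \<beta>"
  shows "sesquilinear scale id \<beta>" "\<beta> v u = \<beta> u v"
proof -
  show "sesquilinear scale id \<beta>"
    using assms unfolding symmetric_form_def bilinear_form_def Vector_Spaces.linear_iff
    by (simp add: sesquilinear_def biadditive_def additive_def)
  show "\<beta> v u = \<beta> u v"
    using assms unfolding symmetric_form_def by blast
qed

lemma hermitian_form_sesquilinear:
  fixes scale :: "'f::{field,finite} \<Rightarrow> 'v::ab_group_add \<Rightarrow> 'v"
  assumes "hermitian_form q scale \<beta>" "CARD('f) = q\<^sup>2"
  shows "sesquilinear scale (\<lambda>c. c ^ q) \<beta>" "\<beta> v u = \<beta> u v ^ q"
proof -
  have l: "\<beta> (u + w) v = \<beta> u v + \<beta> w v" "\<beta> (scale c u) v = c * \<beta> u v" and h: "\<beta> v u = \<beta> u v ^ q" for c u v w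
    using assms(1) unfolding hermitian_form_def Vector_Spaces.linear_iff by blast+
  have "\<beta> v (u + w) = \<beta> v u + \<beta> v w" for u v w
    using additive_power_finite_field[of q 2 "\<beta> u v" "\<beta> w v"] assms(2) l(1)[of u w v]
    by (simp add: h[of v "u + w"] h[of v u] h[of v w])
  moreover have "\<beta> v (scale c u) = c ^ q * \<beta> v u" for c u v
    by (simp add: h[of v "scale c u"] h[of v u] l(2) power_mult_distrib)
  ultimately show "sesquilinear scale (\<lambda>c. c ^ q) \<beta>"
    using l by (simp add: sesquilinear_def biadditive_def additive_def)
  show "\<beta> v u = \<beta> u v ^ q"
    by (rule h)
qed

lemma sesquilinear_pullback:
  assumes "sesquilinear scale \<psi> \<beta>" "additive g" "\<And>c v. g (scale c v) = scale c (g v)"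
  shows "sesquilinear scale \<psi> (\<lambda>u v. \<beta> (g u) (g v))"
  using assms(3) by (simp add: sesquilinear_def biadditive_def additive_def sesquilinear_simps[OF assms(1)]
      additive_simps[OF assms(2)])

lemma nondegenerate_pullback:
  assumes "nondegenerate \<beta>" "additive g" "bij g"
  shows "nondegenerate (\<lambda>u v. \<beta> (g u) (g v))"
  unfolding nondegenerate_def
proof (intro allI impI)
  fix u assume "\<forall>v. \<beta> (g u) (g v) = 0"
  then have "\<beta> (g u) w = 0" for w
    using bij_is_surj[OF assms(3)] by (metis surjD)
  then have "g u = g 0"
    using assms(1) additive_simps(2)[OF assms(2)] by (simp add: nondegenerate_def)
  then show "u = 0"
    using bij_is_inj[OF assms(3)] by (simp add: inj_eq)
qed

lemma conjugator_eigenspace: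
  assumes "vector_space scale" "g \<in> carrier (general_linear scale)" "\<And>v. Y (g v) = g (X v)"
  shows "bij_betw g (eigenspace scale X c) (eigenspace scale Y c)"
proof -
  have g: "additive g" "\<And>c v. g (scale c v) = scale c (g v)" "bij g"
    using assms carrier_general_linear_iff by blast+
  have iff: "g v \<in> eigenspace scale Y c \<longleftrightarrow> v \<in> eigenspace scale X c" for v
    using bij_is_inj[OF g(3)] by (simp add: eigenspace_def assms(3) inj_eq flip: g(2))
  show ?thesis
    unfolding bij_betw_def
  proof
    show "inj_on g (eigenspace scale X c)"
      using bij_is_inj[OF g(3)] by (rule inj_on_subset) simp
    show "g ` eigenspace scale X c = eigenspace scale Y c"
    proof (intro equalityI subsetI)
      fix w assume "w \<in> g ` eigenspace scale X c"
      then show "w \<in> eigenspace scale Y c"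
        using iff by blast
    next
      fix w assume "w \<in> eigenspace scale Y c"
      moreover obtain v where "w = g v"
        using bij_is_surj[OF g(3)] by (rule surjE)
      ultimately show "w \<in> g ` eigenspace scale X c"
        using iff by blast
    qed
  qed
qed

theorem theorem4p1p1:
  fixes scale :: "'f::{field,finite} \<Rightarrow> 'v::ab_group_add \<Rightarrow> 'v"
    and Basis :: "'v set"
    and \<beta> :: "'v \<Rightarrow> 'v \<Rightarrow> 'f"
    and q :: nat
    and X1 X2 :: "'v \<Rightarrow> 'v"
  assumes "finite_dimensional_vector_space scale Basis"
    and "nondegenerate \<beta>"
    and "X1 \<in> carrier (isometry_group scale \<beta>)" and "semisimple scale X1"
    and "X2 \<in> carrier (isometry_group scale \<beta>)" and "semisimple scale X2"
  shows "((alternating_form scale \<beta> \<and> CARD('f) = q) \<or>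
          (hermitian_form q scale \<beta> \<and> CARD('f) = q\<^sup>2) \<longrightarrow>
            (conjugate_in (isometry_group scale \<beta>) X1 X2 \<longleftrightarrow>
             conjugate_in (general_linear scale) X1 X2)) \<and>
         (symmetric_form scale \<beta> \<and> CARD('f) = q \<and> odd q \<longrightarrow>
            (conjugate_in (isometry_group scale \<beta>) X1 X2 \<longleftrightarrow>
             conjugate_in (general_linear scale) X1 X2 \<and>
             (\<forall>c\<in>{1, -1}. congruent_on scale \<beta> (eigenspace scale X1 c)
                                   scale \<beta> (eigenspace scale X2 c))))"
proof -
  note fd = assms(1) and nd = assms(2)
  interpret finite_dimensional_vector_space scale Basis
    by (rule fd)
  note vs = vector_space_axioms
  note gl = carrier_general_linear_iff[OF vs]
  note fin = finite_UNIV_vector_space[OF fd]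
  interpret op: finite_order_operator scale X1 "inv_into UNIV X1" "group.ord (general_linear scale) X1"
    by (rule semisimple_finite_order_operator[OF fd assms(4)])
  let ?GL = "general_linear scale" and ?C = "isometry_group scale \<beta>"
  have XG: "X1 \<in> carrier ?GL" "X2 \<in> carrier ?GL"
    and X\<beta>: "\<beta> (X1 u) (X1 v) = \<beta> u v" "\<beta> (X2 u) (X2 v) = \<beta> u v" for u v
    using assms(3,5) by (auto simp: isometry_group_def)
  note conjC = conjugate_in_isometry_group[OF vs assms(3,5)]
    and conjG = conjugate_in_general_linear[OF vs XG]
  have CG: "conjugate_in ?GL X1 X2" if "conjugate_in ?C X1 X2"
    using that unfolding conjC conjG by (auto simp: isometry_group_def)
  let ?\<gamma> = "\<lambda>g u v. \<beta> (g u) (g v)"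
  \<comment> \<open>Shared by the alternating case, with \<open>\<phi>\<close> the negation, and the
    symmetric case, with \<open>\<phi>\<close> the identity.\<close>
  have bilinear: "conjugate_in ?C X1 X2"
    if \<beta>: "sesquilinear scale id \<beta>" "\<And>u v. \<beta> v u = \<phi> (\<beta> u v)"
      and g: "g \<in> carrier ?GL" "\<And>v. X2 (g v) = g (X1 v)"
      and cong: "\<And>c. c \<in> {1, -1} \<Longrightarrow>
        congruent_on scale \<beta> (eigenspace scale X1 c) scale (?\<gamma> g) (eigenspace scale X1 c)"
    for g \<phi>
  proof -
    have g': "additive g" "\<And>c v. g (scale c v) = scale c (g v)" "bij g"
      using g(1) gl by blast+
    have "\<exists>T. additive T \<and> (\<forall>c v. T (scale c v) = scale c (T v)) \<and> (\<forall>v. T (X1 v) = X1 (T v)) \<and>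
        (\<forall>u v. \<beta> (T u) (T v) = ?\<gamma> g u v)"
    proof (rule equivariant_isometry_bilinear[where \<beta> = \<beta> and \<gamma> = "?\<gamma> g" and \<phi> = \<phi>,
          OF fd op.finite_order_operator_axioms])
      show "sesquilinear scale id (?\<gamma> g)"
        by (rule sesquilinear_pullback[where g = g and \<beta> = \<beta> and scale = scale, OF \<beta>(1) g'(1,2)])
      show "nondegenerate (?\<gamma> g)"
        by (rule nondegenerate_pullback[OF nd g'(1,3)])
      show "?\<gamma> g (X1 u) (X1 v) = ?\<gamma> g u v" for u v
        using X\<beta>(2)[of "g u" "g v"] by (simp only: g(2))
    qed (rule \<beta> nd X\<beta>(1) | rule cong, assumption)+
    then obtain T where T: "additive T" "\<And>c v. T (scale c v) = scale c (T v)" "\<And>v. T (X1 v) = X1 (T v)"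
      "\<And>u v. \<beta> (T u) (T v) = \<beta> (g u) (g v)"
      by (elim exE conjE) simp
    show ?thesis
      unfolding conjC
      by (rule isometry_conjugator[where g = g and X = X1 and Y = X2 and T = T and \<beta> = \<beta>,
            OF vs fin sesquilinear_simps(1)[OF \<beta>(1)] nd g T])
  qed
  have alternating: "conjugate_in ?C X1 X2"
    if alt: "alternating_form scale \<beta>" and conj: "conjugate_in ?GL X1 X2"
  proof -
    obtain g where g: "g \<in> carrier ?GL" "\<And>v. X2 (g v) = g (X1 v)"
      using conj unfolding conjG by blast
    have g': "additive g" "\<And>c v. g (scale c v) = scale c (g v)" "bij g"
      using g(1) gl by blast+
    note \<beta> = alternating_form_sesquilinear[OF alt]
    note \<gamma> = sesquilinear_pullback[where g = g and \<beta> = \<beta> and scale = scale, OF \<beta>(1) g'(1,2)]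
    have X\<gamma>: "?\<gamma> g (X1 u) (X1 v) = ?\<gamma> g u v" for u v
      using X\<beta>(2)[of "g u" "g v"] by (simp only: g(2))
    show ?thesis
    proof (rule bilinear[of uminus g])
      fix c :: 'f assume "c \<in> {1, -1}"
      then have c: "c = 1 \<or> c = -1"
        by simp
      \<comment> \<open>Two non-degenerate alternating forms are compared on one and the same space,
        so the cardinalities agree trivially.\<close>
      show "congruent_on scale \<beta> (eigenspace scale X1 c) scale (?\<gamma> g) (eigenspace scale X1 c)"
      proof (rule alternating_congruent_on[OF vs fin])
        show "nondegenerate_on \<beta> (eigenspace scale X1 c)"
          by (rule op.eigenspace_nondegenerate[where \<beta> = \<beta>, OF sesquilinear_simps(1)[OF \<beta>(1)] X\<beta>(1) nd c])
        show "nondegenerate_on (?\<gamma> g) (eigenspace scale X1 c)"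
          by (rule op.eigenspace_nondegenerate[where \<beta> = "?\<gamma> g", OF sesquilinear_simps(1)[OF \<gamma>] X\<gamma>
                nondegenerate_pullback[OF nd g'(1,3)] c])
      qed (rule \<beta> \<gamma> op.subspace_eigenspace refl)+
    qed (rule \<beta> g)+
  qed
  have hermitian: "conjugate_in ?C X1 X2"
    if herm: "hermitian_form q scale \<beta>" "CARD('f) = q\<^sup>2" and conj: "conjugate_in ?GL X1 X2"
  proof -
    obtain g where g: "g \<in> carrier ?GL" "\<And>v. X2 (g v) = g (X1 v)"
      using conj unfolding conjG by blast
    have g': "additive g" "\<And>c v. g (scale c v) = scale c (g v)" "bij g"
      using g(1) gl by blast+
    note \<beta> = hermitian_form_sesquilinear[OF herm]
    have "q > 1"
      using card_UNIV_gt_1[where ?'f = 'f] herm(2) by (cases "q = 0 \<or> q = 1") auto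
    moreover have "q < CARD('f)"
      using \<open>q > 1\<close> herm(2) by (simp add: power2_eq_square)
    ultimately obtain a :: 'f where a: "a ^ q \<noteq> a"
      using power_not_identity_finite_field by blast
    \<comment> \<open>Hermitian symmetry is applied twice to \<open>\<beta> (scale a u) v\<close>;
      each application raises the scalar to the power \<open>q\<close>.\<close>
    have a': "(a ^ q) ^ q * \<beta> u v = a * \<beta> u v" for u v
    proof -
      have "\<beta> (scale a u) v = \<beta> v (scale a u) ^ q"
        by (rule \<beta>(2))
      also have "\<dots> = (a ^ q) ^ q * \<beta> v u ^ q"
        by (simp add: sesquilinear_simps[OF \<beta>(1)] power_mult_distrib)
      also have "\<beta> v u ^ q = \<beta> u v"
        by (rule \<beta>(2)[symmetric])
      finally show ?thesis
        by (simp only: sesquilinear_simps[OF \<beta>(1)])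
    qed
    have "\<exists>T. additive T \<and> (\<forall>c v. T (scale c v) = scale c (T v)) \<and> (\<forall>v. T (X1 v) = X1 (T v)) \<and>
        (\<forall>u v. \<beta> (T u) (T v) = ?\<gamma> g u v)"
    proof (rule equivariant_isometry_hermitian[where \<beta> = \<beta> and \<gamma> = "?\<gamma> g" and \<phi> = "\<lambda>c. c ^ q"
          and \<psi> = "\<lambda>c. c ^ q" and a = a, OF fd op.X_additive op.X_scale op.X_X'])
      show "sesquilinear scale (\<lambda>c. c ^ q) (?\<gamma> g)"
        by (rule sesquilinear_pullback[where g = g and \<beta> = \<beta> and scale = scale, OF \<beta>(1) g'(1,2)])
      show "nondegenerate (?\<gamma> g)"
        by (rule nondegenerate_pullback[OF nd g'(1,3)])
      show "?\<gamma> g (X1 u) (X1 v) = ?\<gamma> g u v" for u v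
        using X\<beta>(2)[of "g u" "g v"] by (simp only: g(2))
    qed (rule \<beta> nd X\<beta>(1) a a')+
    then obtain T where T: "additive T" "\<And>c v. T (scale c v) = scale c (T v)" "\<And>v. T (X1 v) = X1 (T v)"
      "\<And>u v. \<beta> (T u) (T v) = \<beta> (g u) (g v)"
      by (elim exE conjE) simp
    show ?thesis
      unfolding conjC
      by (rule isometry_conjugator[where g = g and X = X1 and Y = X2 and T = T and \<beta> = \<beta>,
            OF vs fin sesquilinear_simps(1)[OF \<beta>(1)] nd g T])
  qed
  have symmetric: "conjugate_in ?C X1 X2"
    if sym: "symmetric_form scale \<beta>" and conj: "conjugate_in ?GL X1 X2"
      and cong: "\<forall>c\<in>{1, -1}. congruent_on scale \<beta> (eigenspace scale X1 c) scale \<beta> (eigenspace scale X2 c)"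
  proof -
    obtain g where g: "g \<in> carrier ?GL" "\<And>v. X2 (g v) = g (X1 v)"
      using conj unfolding conjG by blast
    have g': "additive g" "\<And>c v. g (scale c v) = scale c (g v)"
      using g(1) gl by blast+
    note \<beta> = symmetric_form_sesquilinear[OF sym]
    show ?thesis
    proof (rule bilinear[of id g])
      fix c :: 'f assume c: "c \<in> {1, -1}"
      note bij = conjugator_eigenspace[where g = g and X = X1 and Y = X2 and c = c, OF vs g]
      have gE: "g v \<in> eigenspace scale X2 c" if "v \<in> eigenspace scale X1 c" for v
        using bij that by (rule bij_betw_apply)
      obtain T where T: "bij_betw T (eigenspace scale X2 c) (eigenspace scale X1 c)"
        "\<forall>u\<in>eigenspace scale X2 c. \<forall>v\<in>eigenspace scale X2 c. T (u + v) = T u + T v"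
        "\<forall>a. \<forall>v\<in>eigenspace scale X2 c. T (scale a v) = scale a (T v)"
        "\<forall>u\<in>eigenspace scale X2 c. \<forall>v\<in>eigenspace scale X2 c. \<beta> (T u) (T v) = \<beta> u v"
        using bspec[OF cong c] unfolding congruent_on_def by (elim exE conjE)
      show "congruent_on scale \<beta> (eigenspace scale X1 c) scale (?\<gamma> g) (eigenspace scale X1 c)"
        unfolding congruent_on_def
      \<comment> \<open>\<open>g\<close> identifies the eigenspace of \<open>X1\<close> under the
        pulled-back form with the eigenspace of \<open>X2\<close> under \<open>\<beta>\<close>; the
        given congruence \<open>T\<close> leads back to the eigenspace of \<open>X1\<close>.\<close>
      proof (intro exI[of _ "T \<circ> g"] conjI)
        show "bij_betw (T \<circ> g) (eigenspace scale X1 c) (eigenspace scale X1 c)"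
          by (rule bij_betw_trans[OF bij T(1)])
      qed (use T(2-4) gE g' in \<open>simp_all add: additive_simps\<close>)
    qed (simp_all only: \<beta> g id_apply)
  qed
  have congruent: "congruent_on scale \<beta> (eigenspace scale X1 c) scale \<beta> (eigenspace scale X2 c)"
    if conj: "conjugate_in ?C X1 X2" for c
  proof -
    obtain g where g: "g \<in> carrier ?C" "\<And>v. X2 (g v) = g (X1 v)"
      using conj unfolding conjC by blast
    then have gG: "g \<in> carrier ?GL" and g\<beta>: "\<And>u v. \<beta> (g u) (g v) = \<beta> u v"
      by (auto simp: isometry_group_def)
    have g': "additive g" "\<And>c v. g (scale c v) = scale c (g v)" "bij g"
      using gG gl by blast+
    \<comment> \<open>The inverse is taken because \<open>congruent_on\<close> asks for a map from
      the second space to the first, whereas \<open>g\<close> carries the eigenspaces of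
      \<open>X1\<close> to those of \<open>X2\<close>.\<close>
    let ?T = "inv_into UNIV g"
    have gT: "g (?T v) = v" and Tg: "?T (g v) = v" for v
      using bij_is_surj[OF g'(3)] bij_is_inj[OF g'(3)] by (simp_all add: surj_f_inv_f)
    note bij = conjugator_eigenspace[where g = g and X = X1 and Y = X2 and c = c, OF vs gG g(2)]
    show ?thesis
      unfolding congruent_on_def
    proof (intro exI[of _ ?T] conjI ballI allI)
      show "bij_betw ?T (eigenspace scale X2 c) (eigenspace scale X1 c)"
        unfolding bij_betw_imp_surj_on[OF bij, symmetric]
        by (intro bij_betw_byWitness[where f' = g]) (auto simp: Tg)
      show "?T (u + v) = ?T u + ?T v" for u v
        using Tg[of "?T u + ?T v"] by (simp add: additive_simps[OF g'(1)] gT)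
      show "?T (scale a v) = scale a (?T v)" for a v
        using Tg[of "scale a (?T v)"] by (simp add: g'(2) gT)
      show "\<beta> (?T u) (?T v) = \<beta> u v" for u v
        using g\<beta>[of "?T u" "?T v"] by (simp add: gT)
    qed
  qed
  show ?thesis
    using CG alternating hermitian symmetric congruent by blast
qed

end
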